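(* Let $\Omega=[0,1]\setminus\mathbf{Q}$, let $\mathbf{N}=\{1,2,3,\ldots\}$, and let $\mathbf{N}^{\infty}$ be the set of all infinite sequences $(n_i)_{i\ge 1}$ with $n_i\in\mathbf{N}$. Let $\{s_i : i\in\mathbf{N}\}$ be the canonical generators of the Cuntz algebra $\mathcal{O}_\infty$. Let $(l_2(\Omega),\pi_\alpha)$ be the representation of $\mathcal{O}_\infty$ given by $$\pi_\alpha(s_i)e_x = e_{\alpha_i(x)},\qquad \alpha_i(x)=\frac{1}{x+i}\qquad (x\in\Omega,\ i\in\mathbf{N}),$$ and let $(l_2(\mathbf{N}^\infty),\pi_\beta)$ be the representation of $\mathcal{O}_\infty$ given by $$\pi_\beta(s_i)e_a=e_{\beta_i(a)},\qquad \beta_i(n_1,n_2,\ldots)=(i,n_1,n_2,\ldots)\qquad (a=(n_1,n_2,\ldots)\in\mathbf{N}^\infty,\ i\in\mathbf{N}).$$ Then the representations $(l_2(\Omega),\pi_\alpha)$ and $(l_2(\mathbf{N}^\infty),\pi_\beta)$ of $\mathcal{O}_\infty$ are unitarily equivalent.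
   Context: The Cuntz algebra $\mathcal{O}_\infty$ is the C$^*$-algebra universally generated by $\{s_i: i\in\mathbf{N}\}$ satisfying $s_i^*s_j=\delta_{ij}I$ for $i,j\in\mathbf{N}$ and $\sum_{i=1}^k s_is_i^*\le I$ for every $k\in\mathbf{N}$, where $I$ is the unit of $\mathcal{O}_\infty$. Any family $\{t_i:i\in\mathbf{N}\}$ of bounded operators on a Hilbert space satisfying the same relations determines a unique unital $*$-representation of $\mathcal{O}_\infty$ with $s_i\mapsto t_i$; so it suffices to specify a representation on the generators. A representation of $\mathcal{O}_\infty$ is a pair $(\mathcal{H},\pi)$ with $\mathcal{H}$ a complex Hilbert space and $\pi$ a $*$-homomorphism from $\mathcal{O}_\infty$ to the algebra of bounded linear operators on $\mathcal{H}$. Two representations $(\mathcal{H}_1,\pi_1)$, $(\mathcal{H}_2,\pi_2)$ are unitarily equivalent if there is a unitary $u$ from $\mathcal{H}_1$ onto $\mathcal{H}_2$ with $u\pi_1(x)u^*=\pi_2(x)$ for every $x\in\mathcal{O}_\infty$. For a nonempty set $A$, $l_2(A)$ is the complex Hilbert space with orthonormal (standard) basis $\{e_a: a\in A\}$. *)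

theory Defs
  imports "HOL-Analysis.Analysis" "HOL-Algebra.Module"
begin

section \<open>Unital C*-algebras\<close>

definition complex_ring :: "complex ring" where
  "complex_ring = \<lparr>carrier = UNIV, monoid.mult = (*), one = 1, ring.zero = 0, add = (+)\<rparr>"

record 'a star_algebra = "(complex, 'a) module" +
  adj :: "'a \<Rightarrow> 'a"
  nrm :: "'a \<Rightarrow> real"

locale unital_cstar_algebra = module complex_ring A + ring A
  for A :: "'a star_algebra" (structure) +
  assumes smult_mult_left:
      "\<lbrakk>x \<in> carrier A; y \<in> carrier A\<rbrakk> \<Longrightarrow> (c \<odot> x) \<otimes> y = c \<odot> (x \<otimes> y)"
    and smult_mult_right:
      "\<lbrakk>x \<in> carrier A; y \<in> carrier A\<rbrakk> \<Longrightarrow> x \<otimes> (c \<odot> y) = c \<odot> (x \<otimes> y)"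
    and adj_closed: "x \<in> carrier A \<Longrightarrow> adj A x \<in> carrier A"
    and adj_adj: "x \<in> carrier A \<Longrightarrow> adj A (adj A x) = x"
    and adj_add:
      "\<lbrakk>x \<in> carrier A; y \<in> carrier A\<rbrakk> \<Longrightarrow> adj A (x \<oplus> y) = adj A x \<oplus> adj A y"
    and adj_smult: "x \<in> carrier A \<Longrightarrow> adj A (c \<odot> x) = cnj c \<odot> adj A x"
    and adj_mult:
      "\<lbrakk>x \<in> carrier A; y \<in> carrier A\<rbrakk> \<Longrightarrow> adj A (x \<otimes> y) = adj A y \<otimes> adj A x"
    and nrm_nonneg: "x \<in> carrier A \<Longrightarrow> 0 \<le> nrm A x"
    and nrm_eq_0_iff: "x \<in> carrier A \<Longrightarrow> nrm A x = 0 \<longleftrightarrow> x = \<zero>"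
    and nrm_triangle:
      "\<lbrakk>x \<in> carrier A; y \<in> carrier A\<rbrakk> \<Longrightarrow> nrm A (x \<oplus> y) \<le> nrm A x + nrm A y"
    and nrm_smult: "x \<in> carrier A \<Longrightarrow> nrm A (c \<odot> x) = cmod c * nrm A x"
    and nrm_mult:
      "\<lbrakk>x \<in> carrier A; y \<in> carrier A\<rbrakk> \<Longrightarrow> nrm A (x \<otimes> y) \<le> nrm A x * nrm A y"
    and cstar_identity: "x \<in> carrier A \<Longrightarrow> nrm A (adj A x \<otimes> x) = (nrm A x)\<^sup>2"
    and nrm_complete:
      "\<lbrakk>\<And>n. \<sigma> n \<in> carrier A;
        \<And>e. e > 0 \<Longrightarrow> \<exists>N. \<forall>m\<ge>N. \<forall>n\<ge>N. nrm A (\<sigma> m \<ominus> \<sigma> n) < e\<rbrakk>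
       \<Longrightarrow> \<exists>x\<in>carrier A. (\<lambda>n. nrm A (\<sigma> n \<ominus> x)) \<longlonglongrightarrow> 0"

text \<open>As usual for representations, a *-homomorphism is not required to preserve the unit.\<close>

definition star_hom :: "'a star_algebra \<Rightarrow> 'b star_algebra \<Rightarrow> ('a \<Rightarrow> 'b) \<Rightarrow> bool" where
  "star_hom A B \<phi> \<longleftrightarrow>
     \<phi> \<in> carrier A \<rightarrow> carrier B \<and>
     (\<forall>x\<in>carrier A. \<forall>y\<in>carrier A. \<phi> (x \<oplus>\<^bsub>A\<^esub> y) = \<phi> x \<oplus>\<^bsub>B\<^esub> \<phi> y) \<and>
     (\<forall>c. \<forall>x\<in>carrier A. \<phi> (c \<odot>\<^bsub>A\<^esub> x) = c \<odot>\<^bsub>B\<^esub> \<phi> x) \<and>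
     (\<forall>x\<in>carrier A. \<forall>y\<in>carrier A. \<phi> (x \<otimes>\<^bsub>A\<^esub> y) = \<phi> x \<otimes>\<^bsub>B\<^esub> \<phi> y) \<and>
     (\<forall>x\<in>carrier A. \<phi> (adj A x) = adj B (\<phi> x))"

text \<open>The positive elements of a C*-algebra are those of the form $z^* z$.\<close>

definition cstar_le :: "'a star_algebra \<Rightarrow> 'a \<Rightarrow> 'a \<Rightarrow> bool" where
  "cstar_le A x y \<longleftrightarrow> (\<exists>z\<in>carrier A. y \<ominus>\<^bsub>A\<^esub> x = adj A z \<otimes>\<^bsub>A\<^esub> z)"


section \<open>The Cuntz algebra on infinitely many generators\<close>

text \<open>Generators are indexed by the positive integers; the value at \<open>0\<close> is irrelevant.\<close>

definition cuntz_family :: "'a star_algebra \<Rightarrow> (nat \<Rightarrow> 'a) \<Rightarrow> bool" where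
  "cuntz_family A s \<longleftrightarrow>
     (\<forall>i\<ge>1. s i \<in> carrier A) \<and>
     (\<forall>i\<ge>1. \<forall>j\<ge>1. adj A (s i) \<otimes>\<^bsub>A\<^esub> s j = (if i = j then \<one>\<^bsub>A\<^esub> else \<zero>\<^bsub>A\<^esub>)) \<and>
     (\<forall>k\<ge>1. cstar_le A (\<Oplus>\<^bsub>A\<^esub>i\<in>{1..k}. s i \<otimes>\<^bsub>A\<^esub> adj A (s i)) \<one>\<^bsub>A\<^esub>)"

text \<open>
  \<open>A\<close> with \<open>s\<close> is the C*-algebra universally generated by a Cuntz family. A HOL definition
  cannot quantify over types, so the universal property refers to all unital C*-algebras with
  elements in the type \<open>'b\<close>. A theorem assuming it for particular types \<open>'b\<close>
  assumes less than the full universal property.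
\<close>

definition cuntz_algebra_infinity :: "'b itself \<Rightarrow> 'a star_algebra \<Rightarrow> (nat \<Rightarrow> 'a) \<Rightarrow> bool" where
  "cuntz_algebra_infinity TYPE('b) A s \<longleftrightarrow>
     unital_cstar_algebra A \<and> cuntz_family A s \<and>
     (\<forall>(B :: 'b star_algebra) t. unital_cstar_algebra B \<and> cuntz_family B t \<longrightarrow>
        (\<exists>!\<phi>. \<phi> \<in> extensional (carrier A) \<and> star_hom A B \<phi> \<and> \<phi> \<one>\<^bsub>A\<^esub> = \<one>\<^bsub>B\<^esub> \<and>
              (\<forall>i\<ge>1. \<phi> (s i) = t i)))"


section \<open>The Hilbert spaces $l_2(X)$ and their bounded operators\<close>

definition l2 :: "'x set \<Rightarrow> ('x \<Rightarrow> complex) set" where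
  "l2 X = {f. (\<forall>x. x \<notin> X \<longrightarrow> f x = 0) \<and> (\<lambda>x. (cmod (f x))\<^sup>2) summable_on X}"

definition l2_inner :: "('x \<Rightarrow> complex) \<Rightarrow> ('x \<Rightarrow> complex) \<Rightarrow> complex" where
  "l2_inner f g = (\<Sum>\<^sub>\<infinity>x. cnj (f x) * g x)"

definition l2_norm :: "('x \<Rightarrow> complex) \<Rightarrow> real" where
  "l2_norm f = sqrt (\<Sum>\<^sub>\<infinity>x. (cmod (f x))\<^sup>2)"

definition l2_basis :: "'x \<Rightarrow> 'x \<Rightarrow> complex" where
  "l2_basis x = (\<lambda>y. if y = x then 1 else 0)"

type_synonym ('x, 'y) l2_operator = "('x \<Rightarrow> complex) \<Rightarrow> ('y \<Rightarrow> complex)"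

text \<open>Operators are extensional on \<open>l2 X\<close>, so that equal operators are equal HOL functions.\<close>

definition l2_op :: "'x set \<Rightarrow> 'y set \<Rightarrow> ('x, 'y) l2_operator set" where
  "l2_op X Y = {T \<in> l2 X \<rightarrow>\<^sub>E l2 Y.
     (\<forall>f\<in>l2 X. \<forall>g\<in>l2 X. T (\<lambda>x. f x + g x) = (\<lambda>y. T f y + T g y)) \<and>
     (\<forall>c. \<forall>f\<in>l2 X. T (\<lambda>x. c * f x) = (\<lambda>y. c * T f y)) \<and>
     (\<exists>K. \<forall>f\<in>l2 X. l2_norm (T f) \<le> K * l2_norm f)}"

text \<open>For a bounded \<open>T\<close>, the vector \<open>h\<close> exists and is unique by the Riesz representation theorem.\<close>

definition l2_adj :: "'x set \<Rightarrow> 'y set \<Rightarrow> ('x, 'y) l2_operator \<Rightarrow> ('y, 'x) l2_operator" where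
  "l2_adj X Y T =
     (\<lambda>g\<in>l2 Y. THE h. h \<in> l2 X \<and> (\<forall>f\<in>l2 X. l2_inner (T f) g = l2_inner f h))"

definition l2_unitary :: "'x set \<Rightarrow> 'y set \<Rightarrow> ('x, 'y) l2_operator \<Rightarrow> bool" where
  "l2_unitary X Y u \<longleftrightarrow> u \<in> l2_op X Y \<and>
     compose (l2 X) (l2_adj X Y u) u = (\<lambda>f\<in>l2 X. f) \<and>
     compose (l2 Y) u (l2_adj X Y u) = (\<lambda>g\<in>l2 Y. g)"

definition l2_op_algebra :: "'x set \<Rightarrow> ('x, 'x) l2_operator star_algebra" where
  "l2_op_algebra X =
     \<lparr>carrier = l2_op X X,
      monoid.mult = (\<lambda>S T. compose (l2 X) S T),
      one = (\<lambda>f\<in>l2 X. f),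
      ring.zero = (\<lambda>f\<in>l2 X. \<lambda>x. 0),
      add = (\<lambda>S T. \<lambda>f\<in>l2 X. \<lambda>x. S f x + T f x),
      smult = (\<lambda>c T. \<lambda>f\<in>l2 X. \<lambda>x. c * T f x),
      adj = l2_adj X X,
      nrm = (\<lambda>T. SUP f\<in>{f \<in> l2 X. l2_norm f \<le> 1}. l2_norm (T f))\<rparr>"


section \<open>Representations\<close>

definition l2_representation ::
    "'a star_algebra \<Rightarrow> 'x set \<Rightarrow> ('a \<Rightarrow> ('x, 'x) l2_operator) \<Rightarrow> bool" where
  "l2_representation A X \<pi> \<longleftrightarrow> star_hom A (l2_op_algebra X) \<pi>"

definition unitarily_equivalent ::
    "'a star_algebra \<Rightarrow> 'x set \<Rightarrow> ('a \<Rightarrow> ('x, 'x) l2_operator) \<Rightarrow>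
     'y set \<Rightarrow> ('a \<Rightarrow> ('y, 'y) l2_operator) \<Rightarrow> bool" where
  "unitarily_equivalent A X \<pi>\<^sub>1 Y \<pi>\<^sub>2 \<longleftrightarrow>
     (\<exists>u. l2_unitary X Y u \<and>
        (\<forall>a\<in>carrier A. compose (l2 Y) u (compose (l2 Y) (\<pi>\<^sub>1 a) (l2_adj X Y u)) = \<pi>\<^sub>2 a))"


section \<open>The two branching function systems\<close>

definition Omega :: "real set" where
  "Omega = {0..1} - \<rat>"

definition alpha :: "nat \<Rightarrow> real \<Rightarrow> real" where
  "alpha i x = 1 / (x + real i)"

text \<open>A sequence $(n_1, n_2, \ldots)$ is the function \<open>a\<close> with $a\,k = n_{k+1}$.\<close>

definition Ninf :: "(nat \<Rightarrow> nat) set" where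
  "Ninf = {a. \<forall>k. a k \<ge> 1}"

definition beta :: "nat \<Rightarrow> (nat \<Rightarrow> nat) \<Rightarrow> (nat \<Rightarrow> nat)" where
  "beta i a = case_nat i a"

end

theory Submission
  imports Defs
begin

text \<open>
The two families of maps are conjugate. Sending a sequence \<open>a\<close> to the infinite continued
  fraction \<open>1 / (a\<^sub>1 + 1 / (a\<^sub>2 + \<dots>))\<close> is a bijection from \<open>Ninf\<close> onto \<open>Omega\<close>, and prepending \<open>i\<close> to
  the sequence replaces the value \<open>x\<close> by \<open>1 / (i + x)\<close> (\<open>bij_betw_cf_value\<close>, \<open>cf_value_beta\<close>).
  A bijection of the index sets permutes the standard bases, so it induces a unitary \<open>u\<close>, and
  \<open>u \<pi>\<alpha> u\<^sup>*\<close> acts on the basis of the second space exactly as \<open>\<pi>\<beta>\<close> does, for every generator.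

  It remains to pass from basis vectors to operators and from generators to the whole algebra.
  A bounded operator on \<open>l2 X\<close> is determined by its values on the basis, because these values
  determine its adjoint (\<open>l2_op_eqI_basis\<close>). For the second step the universal property says that
  a unital *-homomorphism from the Cuntz algebra into a C*-algebra is determined by the images of
  the generators (\<open>cuntz_star_hom_unique\<close>). It can only be applied once the bounded operators on
  \<open>l2 X\<close> are known to form a unital C*-algebra (\<open>l2_op_unital_cstar_algebra\<close>), and
  once both representations are known to be unital. The latter holds although
  *-homomorphisms may forget the unit: since \<open>s\<^sub>1\<^sup>* s\<^sub>1 = 1\<close> and \<open>s\<^sub>1\<close> acts by an injective map of the
  basis, the image of \<open>1\<close> has the matrix of the identity (\<open>l2_representation_unital\<close>).
\<close>

section \<open>Continued fractions conjugate the two branching function systems\<close>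

lemma alpha_pos: "i \<ge> 1 \<Longrightarrow> 0 \<le> x \<Longrightarrow> 0 < alpha i x"
  by (simp add: alpha_def)

lemma alpha_le_1: "i \<ge> 1 \<Longrightarrow> 0 \<le> x \<Longrightarrow> alpha i x \<le> 1"
  by (simp add: alpha_def)

lemma alpha_nonneg: "i \<ge> 1 \<Longrightarrow> 0 \<le> x \<Longrightarrow> 0 \<le> alpha i x"
  by (simp add: alpha_def)

lemma alpha_diff:
  assumes "i \<ge> 1" "0 \<le> x" "0 \<le> y"
  shows "\<bar>alpha i x - alpha i y\<bar> = \<bar>x - y\<bar> / ((x + real i) * (y + real i))"
proof -
  have p: "x + real i > 0" "y + real i > 0"
    using assms by auto
  have "alpha i x - alpha i y = (y - x) / ((x + real i) * (y + real i))"
    unfolding alpha_def using p by (simp add: diff_frac_eq)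
  then show ?thesis
    using p by (simp add: abs_mult abs_minus_commute)
qed

lemma alpha_nonexpansive:
  assumes "i \<ge> 1" "0 \<le> x" "0 \<le> y"
  shows "\<bar>alpha i x - alpha i y\<bar> \<le> \<bar>x - y\<bar>"
proof -
  have "1 * 1 \<le> (x + real i) * (y + real i)"
    using assms by (intro mult_mono) auto
  then have "\<bar>x - y\<bar> / ((x + real i) * (y + real i)) \<le> \<bar>x - y\<bar> / 1"
    by (intro divide_left_mono) auto
  then show ?thesis
    using alpha_diff[OF assms] by simp
qed

text \<open>A single \<open>alpha 1\<close> has slope \<open>-1\<close> at \<open>0\<close> and is no strict contraction. Two consecutive steps
  are: the product of the two denominators is \<open>1 + i * (x + j) \<ge> 2\<close> at each of the two points.\<close>

lemma alpha_alpha_contraction: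
  assumes "i \<ge> 1" "j \<ge> 1" "0 \<le> x" "0 \<le> y"
  shows "\<bar>alpha i (alpha j x) - alpha i (alpha j y)\<bar> \<le> \<bar>x - y\<bar> / 4"
proof -
  have p: "x + real j > 0" "y + real j > 0"
    using assms by auto
  have two: "2 \<le> 1 + real i * (z + real j)" if "0 \<le> z" for z
  proof -
    have "1 * 1 \<le> real i * (z + real j)"
      using assms that by (intro mult_mono) auto
    then show ?thesis by simp
  qed
  have "\<bar>alpha i (alpha j x) - alpha i (alpha j y)\<bar>
      = \<bar>x - y\<bar> / ((x + real j) * (y + real j)) / ((alpha j x + real i) * (alpha j y + real i))"
    using assms alpha_diff alpha_pos by (simp add: less_imp_le)
  also have "\<dots> = \<bar>x - y\<bar> / (((x + real j) * (alpha j x + real i)) * ((y + real j) * (alpha j y + real i)))"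
    by (simp add: mult_ac)
  also have "(x + real j) * (alpha j x + real i) = 1 + real i * (x + real j)"
    unfolding alpha_def using p by (simp add: field_simps)
  also have "(y + real j) * (alpha j y + real i) = 1 + real i * (y + real j)"
    unfolding alpha_def using p by (simp add: field_simps)
  also have "\<bar>x - y\<bar> / ((1 + real i * (x + real j)) * (1 + real i * (y + real j))) \<le> \<bar>x - y\<bar> / 4"
  proof (rule divide_left_mono)
    show "4 \<le> (1 + real i * (x + real j)) * (1 + real i * (y + real j))"
      using mult_mono[OF two two, of x y] assms two[of x] by simp
    show "0 < (1 + real i * (x + real j)) * (1 + real i * (y + real j)) * 4"
      using two[of x] two[of y] assms by (intro mult_pos_pos) auto
  qed simp
  finally show ?thesis .
qed

text \<open>The finite continued fraction with partial quotients \<open>a 0, \<dots>, a (k - 1)\<close> and tail \<open>x\<close>, that is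
  the composition of the first \<open>k\<close> maps \<open>alpha (a i)\<close> applied to \<open>x\<close>.\<close>

primrec cf_fold :: "nat \<Rightarrow> (nat \<Rightarrow> nat) \<Rightarrow> real \<Rightarrow> real" where
  "cf_fold 0 a x = x"
| "cf_fold (Suc k) a x = alpha (a 0) (cf_fold k (a \<circ> Suc) x)"

lemma Ninf_shift: "a \<in> Ninf \<Longrightarrow> (a \<circ> (+) k) \<in> Ninf"
  by (simp add: Ninf_def)

lemma Ninf_tail: "a \<in> Ninf \<Longrightarrow> (a \<circ> Suc) \<in> Ninf"
  by (simp add: Ninf_def)

lemma Ninf_ge_1: "a \<in> Ninf \<Longrightarrow> 1 \<le> a k"
  by (simp add: Ninf_def)

lemma cf_fold_nonneg: "a \<in> Ninf \<Longrightarrow> 0 \<le> x \<Longrightarrow> 0 \<le> cf_fold k a x"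
proof (induction k arbitrary: a)
  case (Suc k)
  have "0 \<le> cf_fold k (a \<circ> Suc) x"
    using Suc.prems by (intro Suc.IH Ninf_tail)
  then show ?case
    using alpha_nonneg[OF Ninf_ge_1[OF Suc.prems(1)]] by (simp only: cf_fold.simps)
qed simp

lemma cf_fold_le_1:
  assumes "a \<in> Ninf" "0 \<le> x" "x \<le> 1"
  shows "cf_fold k a x \<le> 1"
proof (cases k)
  case (Suc m)
  have "alpha (a 0) (cf_fold m (a \<circ> Suc) x) \<le> 1"
    by (intro alpha_le_1[OF Ninf_ge_1] cf_fold_nonneg Ninf_tail assms)
  then show ?thesis
    by (simp only: Suc cf_fold.simps)
qed (use assms in simp)

text \<open>Two steps contract by \<open>1/4\<close>, so the rate is \<open>1/2\<close> per step; the factor \<open>2\<close> absorbs a leftover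
  single step, which is only nonexpansive.\<close>

lemma cf_fold_contraction:
  assumes "a \<in> Ninf" "0 \<le> x" "0 \<le> y"
  shows "\<bar>cf_fold k a x - cf_fold k a y\<bar> \<le> 2 * (1/2)^k * \<bar>x - y\<bar>"
  using assms(1)
proof (induction k arbitrary: a rule: induct_nat_012)
  case 0
  then show ?case by simp
next
  case 1
  then show ?case using alpha_nonexpansive[OF Ninf_ge_1 assms(2,3)] by simp
next
  case (ge2 n)
  define b where "b = a \<circ> Suc \<circ> Suc"
  have b: "b \<in> Ninf" using ge2.prems by (simp add: Ninf_def b_def)
  have "\<bar>cf_fold (Suc (Suc n)) a x - cf_fold (Suc (Suc n)) a y\<bar>
      \<le> \<bar>cf_fold n b x - cf_fold n b y\<bar> / 4"
    using alpha_alpha_contraction[OF Ninf_ge_1 Ninf_ge_1 cf_fold_nonneg cf_fold_nonneg] ge2.prems b assms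
    by (simp add: b_def)
  also have "\<dots> \<le> (2 * (1/2)^n * \<bar>x - y\<bar>) / 4"
    using ge2.IH(1)[OF b] by (intro divide_right_mono) auto
  also have "\<dots> = 2 * (1/2)^(Suc (Suc n)) * \<bar>x - y\<bar>"
    by simp
  finally show ?case .
qed

lemma cf_fold_add: "cf_fold (k + m) a x = cf_fold k a (cf_fold m (a \<circ> (+) k) x)"
proof (induction k arbitrary: a)
  case 0
  show ?case by (simp add: comp_def)
next
  case (Suc k)
  have "a \<circ> Suc \<circ> (+) k = a \<circ> (+) (Suc k)" by (simp add: fun_eq_iff)
  then show ?case using Suc.IH[of "a \<circ> Suc"] by (simp only: add_Suc[of k m] cf_fold.simps)
qed

definition cf_value :: "(nat \<Rightarrow> nat) \<Rightarrow> real" where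
  "cf_value a = lim (\<lambda>k. cf_fold k a 0)"

text \<open>Later convergents are earlier ones with a different tail in \<open>[0, 1]\<close>, so the contraction makes
  the sequence Cauchy.\<close>

lemma cf_fold_tendsto:
  assumes a: "a \<in> Ninf"
  shows "(\<lambda>k. cf_fold k a 0) \<longlonglongrightarrow> cf_value a"
proof -
  have close: "\<bar>cf_fold k a 0 - cf_fold m a 0\<bar> \<le> 2 * (1/2)^k" if km: "k \<le> m" for k m
  proof -
    obtain d where m: "m = k + d" using le_Suc_ex[OF km] by blast
    define y where "y = cf_fold d (a \<circ> (+) k) 0"
    have y: "0 \<le> y" "y \<le> 1"
      unfolding y_def
      by (rule cf_fold_nonneg[OF Ninf_shift[OF a]], simp) (rule cf_fold_le_1[OF Ninf_shift[OF a]], simp_all)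
    have "\<bar>cf_fold k a 0 - cf_fold m a 0\<bar> \<le> 2 * (1/2)^k * \<bar>0 - y\<bar>"
      unfolding m cf_fold_add y_def[symmetric] using a y by (intro cf_fold_contraction) auto
    also have "\<dots> \<le> 2 * (1/2)^k * 1"
      using y by (intro mult_left_mono) auto
    finally show ?thesis by simp
  qed
  have "Cauchy (\<lambda>k. cf_fold k a 0)"
  proof (rule metric_CauchyI)
    fix e :: real assume e: "0 < e"
    obtain N where N: "(1/2::real)^N < e / 4"
      using real_arch_pow_inv[of "e/4" "1/2"] e by auto
    show "\<exists>M. \<forall>m\<ge>M. \<forall>n\<ge>M. dist (cf_fold m a 0) (cf_fold n a 0) < e"
    proof (intro exI allI impI)
      fix m n assume "N \<le> m" "N \<le> n"
      then have "\<bar>cf_fold N a 0 - cf_fold m a 0\<bar> \<le> 2 * (1/2)^N" "\<bar>cf_fold N a 0 - cf_fold n a 0\<bar> \<le> 2 * (1/2)^N"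
        by (auto intro: close)
      then show "dist (cf_fold m a 0) (cf_fold n a 0) < e"
        unfolding dist_real_def using N by linarith
    qed
  qed
  then show ?thesis
    unfolding cf_value_def by (intro Cauchy_convergent[THEN convergent_LIMSEQ_iff[THEN iffD1]])
qed

lemma cf_value_nonneg: "a \<in> Ninf \<Longrightarrow> 0 \<le> cf_value a"
  by (rule LIMSEQ_le_const[OF cf_fold_tendsto]) (auto intro: cf_fold_nonneg)

lemma cf_value_unfold:
  assumes a: "a \<in> Ninf"
  shows "cf_value a = alpha (a 0) (cf_value (a \<circ> Suc))"
proof -
  let ?b = "a \<circ> Suc"
  have b: "?b \<in> Ninf" using a by (rule Ninf_tail)
  have "(\<lambda>k. cf_fold (Suc k) a 0) \<longlonglongrightarrow> alpha (a 0) (cf_value ?b)"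
    unfolding cf_fold.simps alpha_def
    using cf_fold_tendsto[OF b] cf_value_nonneg[OF b] Ninf_ge_1[OF a, of 0]
    by (intro tendsto_intros) auto
  moreover have "(\<lambda>k. cf_fold (Suc k) a 0) \<longlonglongrightarrow> cf_value a"
    using cf_fold_tendsto[OF a] by (rule LIMSEQ_Suc)
  ultimately show ?thesis by (rule LIMSEQ_unique[symmetric])
qed

lemma cf_value_pos: "a \<in> Ninf \<Longrightarrow> 0 < cf_value a"
  by (subst cf_value_unfold, assumption)
    (intro alpha_pos[OF Ninf_ge_1] cf_value_nonneg Ninf_tail)

lemma cf_value_less_1:
  assumes "a \<in> Ninf"
  shows "cf_value a < 1"
  using cf_value_pos[OF Ninf_tail[OF assms]] Ninf_ge_1[OF assms, of 0]
  by (subst cf_value_unfold[OF assms]) (simp add: alpha_def)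

text \<open>Infinite descent, as in the Euclidean algorithm: if the value is \<open>p / q\<close>, it lies strictly
  between \<open>0\<close> and \<open>1\<close>, and the value of the tail is \<open>q / p - a 0\<close>, a fraction with the smaller
  denominator \<open>p\<close>.\<close>

lemma cf_value_not_fraction:
  assumes "a \<in> Ninf" "q > 0"
  shows "cf_value a \<noteq> real p / real q"
  using assms
proof (induction q arbitrary: a p rule: less_induct)
  case (less q)
  let ?b = "a \<circ> Suc"
  have b: "?b \<in> Ninf" using less.prems by (simp add: Ninf_tail)
  show ?case
  proof
    assume eq: "cf_value a = real p / real q"
    have p: "0 < p" "p < q"
      using cf_value_pos[of a] cf_value_less_1[of a] less.prems eq by (auto simp: zero_less_divide_iff)
    have "(cf_value ?b + real (a 0)) * (real p / real q) = 1"
      using cf_value_unfold[OF less.prems(1)] eq cf_value_pos[OF b] by (simp add: alpha_def)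
    then have tail: "cf_value ?b = (real q - real (a 0) * real p) / real p"
      using p less.prems by (simp add: field_simps)
    then have "0 \<le> real q - real (a 0) * real p"
      using cf_value_pos[OF b] p by (simp add: zero_less_divide_iff)
    then have "a 0 * p \<le> q"
      by (metis diff_ge_0_iff_ge of_nat_le_iff of_nat_mult)
    then have "cf_value ?b = real (q - a 0 * p) / real p"
      using tail by (simp add: of_nat_diff)
    then show False
      using less.IH[OF p(2) b p(1)] by blast
  qed
qed

lemma cf_value_in_Omega:
  assumes a: "a \<in> Ninf"
  shows "cf_value a \<in> Omega"
proof -
  have "cf_value a \<notin> \<rat>"
  proof
    assume "cf_value a \<in> \<rat>"
    then obtain m n where "n \<noteq> 0" "\<bar>cf_value a\<bar> = real m / real n"
      by (rule Rats_abs_nat_div_natE)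
    then show False
      using cf_value_not_fraction[OF a, of n m] cf_value_pos[OF a] by simp
  qed
  then show ?thesis
    using cf_value_pos[OF a] cf_value_less_1[OF a] by (simp add: Omega_def)
qed

lemma Omega_bounds: "x \<in> Omega \<Longrightarrow> 0 < x \<and> x < 1"
  unfolding Omega_def by (metis Diff_iff Rats_0 Rats_1 atLeastAtMost_iff order_le_less)

text \<open>One step of the Gauss map: \<open>i\<close> is the integer part and \<open>y\<close> the fractional part of \<open>1 / x\<close>.\<close>

lemma Omega_decompose:
  assumes x: "x \<in> Omega"
  shows "\<exists>i y. i \<ge> 1 \<and> y \<in> Omega \<and> x = alpha i y"
proof -
  have b: "0 < x" "x < 1" and irr: "x \<notin> \<rat>"
    using Omega_bounds[OF x] x by (auto simp: Omega_def)
  define i where "i = nat \<lfloor>1 / x\<rfloor>"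
  define y where "y = 1 / x - real i"
  have ge: "1 \<le> \<lfloor>1 / x\<rfloor>" using b by simp
  then have i: "i \<ge> 1" "real i = of_int \<lfloor>1 / x\<rfloor>"
    unfolding i_def by linarith+
  have "y \<notin> \<rat>"
  proof
    assume "y \<in> \<rat>"
    then have "1 / (y + real i) \<in> \<rat>" by auto
    then show False using irr by (simp add: y_def)
  qed
  moreover have "0 \<le> y" "y \<le> 1" unfolding y_def i(2) by linarith+
  ultimately have "y \<in> Omega" by (simp add: Omega_def)
  moreover have "x = alpha i y" by (simp add: alpha_def y_def)
  ultimately show ?thesis using i by blast
qed

text \<open>Iterating the Gauss map from \<open>x\<close> yields partial quotients with \<open>x\<close> itself as the finite continued
  fraction whose tail is the \<open>k\<close>-th iterate. That tail is bounded, so contraction forces the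
  convergents to tend to \<open>x\<close>.\<close>

lemma Omega_expand:
  assumes x: "x \<in> Omega"
  shows "\<exists>a\<in>Ninf. cf_value a = x"
proof -
  obtain d G where dG: "\<And>y. y \<in> Omega \<Longrightarrow> d y \<ge> (1::nat) \<and> G y \<in> Omega \<and> y = alpha (d y) (G y)"
    using Omega_decompose by metis
  define dig where "dig y k = d ((G ^^ k) y)" for y k
  have orb: "(G ^^ k) y \<in> Omega" if "y \<in> Omega" for y k
    using that dG by (induction k) auto
  have dig: "dig y \<in> Ninf" if "y \<in> Omega" for y
    using dG orb that by (auto simp: Ninf_def dig_def)
  have tail: "dig y \<circ> Suc = dig (G y)" for y
    by (simp add: fun_eq_iff dig_def funpow_Suc_right del: funpow.simps)
  have fold: "cf_fold k (dig y) ((G ^^ k) y) = y" if "y \<in> Omega" for k y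
    using that
  proof (induction k arbitrary: y)
    case (Suc k)
    have "cf_fold (Suc k) (dig y) ((G ^^ Suc k) y) = alpha (d y) (cf_fold k (dig (G y)) ((G ^^ k) (G y)))"
      by (simp only: cf_fold.simps tail funpow_Suc_right o_apply) (simp add: dig_def)
    also have "\<dots> = y" using Suc.IH[of "G y"] dG[OF Suc.prems] by simp
    finally show ?case .
  qed simp
  have bound: "norm (cf_fold k (dig x) 0 - x) \<le> 2 * (1/2)^k" for k
  proof -
    have o: "0 < (G ^^ k) x" "(G ^^ k) x < 1"
      using Omega_bounds[OF orb[OF x]] by auto
    have "\<bar>cf_fold k (dig x) 0 - cf_fold k (dig x) ((G ^^ k) x)\<bar> \<le> 2 * (1/2)^k * \<bar>0 - (G ^^ k) x\<bar>"
      using dig[OF x] o by (intro cf_fold_contraction) auto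
    also have "\<dots> \<le> 2 * (1/2)^k * 1"
      using o by (intro mult_left_mono) auto
    finally show ?thesis by (simp add: fold[OF x])
  qed
  have "(\<lambda>k. 2 * (1/2::real)^k) \<longlonglongrightarrow> 0"
    by (intro tendsto_mult_right_zero LIMSEQ_power_zero) simp
  then have "(\<lambda>k. cf_fold k (dig x) 0 - x) \<longlonglongrightarrow> 0"
    by (rule Lim_null_comparison[OF always_eventually[rule_format], rotated]) (rule bound)
  then have "(\<lambda>k. cf_fold k (dig x) 0) \<longlonglongrightarrow> x"
    by (simp add: LIM_zero_iff)
  then have "cf_value (dig x) = x"
    using cf_fold_tendsto[OF dig[OF x]] LIMSEQ_unique by blast
  then show ?thesis using dig[OF x] by blast
qed

text \<open>The value of a tail lies strictly between \<open>0\<close> and \<open>1\<close>, so the first partial quotient is the integer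
  part of the reciprocal of the value. Equal values thus have equal first entries and equal tail values.\<close>

lemma cf_value_inj: "inj_on cf_value Ninf"
proof (rule inj_onI)
  fix a b assume ab: "a \<in> Ninf" "b \<in> Ninf" "cf_value a = cf_value b"
  have head: "a 0 = b 0 \<and> cf_value (a \<circ> Suc) = cf_value (b \<circ> Suc)"
    if "a \<in> Ninf" "b \<in> Ninf" "cf_value a = cf_value b" for a b
  proof -
    define s where "s = cf_value (a \<circ> Suc)"
    define t where "t = cf_value (b \<circ> Suc)"
    have st: "0 < s" "s < 1" "0 < t" "t < 1"
      unfolding s_def t_def using that by (auto intro!: cf_value_pos cf_value_less_1 Ninf_tail)
    have "alpha (a 0) s = alpha (b 0) t"
      unfolding s_def t_def using cf_value_unfold that by metis
    then have eq: "s + real (a 0) = t + real (b 0)"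
      by (simp add: alpha_def)
    then have "\<bar>real (a 0) - real (b 0)\<bar> < 1" using st by linarith
    then have "a 0 = b 0" by linarith
    then show ?thesis using eq by (simp add: s_def t_def)
  qed
  have "a k = b k" for k
    using ab
  proof (induction k arbitrary: a b)
    case 0
    then show ?case using head[of a b] by simp
  next
    case (Suc k)
    have "(a \<circ> Suc) k = (b \<circ> Suc) k"
      by (intro Suc.IH Ninf_tail Suc.prems conjunct2[OF head])
    then show ?case by simp
  qed
  then show "a = b" by blast
qed

theorem bij_betw_cf_value: "bij_betw cf_value Ninf Omega"
  unfolding bij_betw_def using cf_value_inj cf_value_in_Omega Omega_expand by blast

lemma beta_in_Ninf: "i \<ge> 1 \<Longrightarrow> a \<in> Ninf \<Longrightarrow> beta i a \<in> Ninf"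
  by (auto simp: Ninf_def beta_def split: nat.split)

lemma beta_Suc: "beta i a \<circ> Suc = a"
  by (simp add: beta_def fun_eq_iff)

lemma inj_on_beta: "inj_on (beta i) S"
  by (rule inj_on_inverseI[where g = "\<lambda>a. a \<circ> Suc"]) (rule beta_Suc)

lemma cf_value_beta:
  assumes "i \<ge> 1" "a \<in> Ninf"
  shows "cf_value (beta i a) = alpha i (cf_value a)"
  by (simp add: cf_value_unfold[OF beta_in_Ninf[OF assms]] beta_Suc) (simp add: beta_def)

section \<open>The Hilbert space of square-summable functions\<close>

lemma l2_summable_UNIV:
  assumes "f \<in> l2 X"
  shows "(\<lambda>x. (cmod (f x))\<^sup>2) summable_on UNIV"
proof -
  have "(\<lambda>x. (cmod (f x))\<^sup>2) summable_on X" and z: "\<And>x. x \<notin> X \<Longrightarrow> f x = 0"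
    using assms by (auto simp: l2_def)
  moreover have "(\<lambda>x. (cmod (f x))\<^sup>2) summable_on X \<longleftrightarrow> (\<lambda>x. (cmod (f x))\<^sup>2) summable_on UNIV"
    by (rule summable_on_cong_neutral) (use z in auto)
  ultimately show ?thesis by blast
qed

lemma l2_outside: "f \<in> l2 X \<Longrightarrow> x \<notin> X \<Longrightarrow> f x = 0"
  by (simp add: l2_def)

text \<open>Together with \<open>l2I\<close> and \<open>l2_norm_leI\<close> this says that the norm is the supremum of the finite partial norms.
  All inequalities in \<open>l2 X\<close> are thereby reduced to those for finite sums.\<close>

lemma L2_set_le_l2_norm:
  assumes "f \<in> l2 X"
  shows "L2_set (\<lambda>x. cmod (f x)) F \<le> l2_norm f"
proof (cases "finite F")
  case True
  then show ?thesis
    unfolding L2_set_def l2_norm_def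
    by (intro real_sqrt_le_mono finite_sum_le_infsum l2_summable_UNIV[OF assms]) auto
next
  case False
  then show ?thesis by (simp add: l2_norm_def infsum_nonneg)
qed

lemma l2_norm_nonneg [simp]: "0 \<le> l2_norm f"
  by (simp add: l2_norm_def infsum_nonneg)

lemma sum_le_of_L2_set_le:
  assumes "L2_set (\<lambda>x. cmod (f x)) F \<le> K"
  shows "(\<Sum>x\<in>F. (cmod (f x))\<^sup>2) \<le> K\<^sup>2"
proof -
  have "(L2_set (\<lambda>x. cmod (f x)) F)\<^sup>2 \<le> K\<^sup>2"
    using assms by (intro power_mono) auto
  then show ?thesis by (simp add: L2_set_def sum_nonneg)
qed

lemma l2I:
  assumes z: "\<And>x. x \<notin> X \<Longrightarrow> f x = 0"
    and K: "\<And>F. finite F \<Longrightarrow> L2_set (\<lambda>x. cmod (f x)) F \<le> K"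
  shows "f \<in> l2 X"
proof -
  have "(\<lambda>x. (cmod (f x))\<^sup>2) summable_on X"
    by (rule nonneg_bdd_above_summable_on)
      (auto intro!: bdd_aboveI2[where M = "K\<^sup>2"] sum_le_of_L2_set_le K)
  then show ?thesis using z by (simp add: l2_def)
qed

lemma l2_norm_leI:
  assumes K: "\<And>F. finite F \<Longrightarrow> L2_set (\<lambda>x. cmod (f x)) F \<le> K"
  shows "l2_norm f \<le> K"
proof -
  have "f \<in> l2 UNIV" by (rule l2I[OF _ K]) auto
  then have "(\<Sum>\<^sub>\<infinity>x. (cmod (f x))\<^sup>2) \<le> K\<^sup>2"
    by (intro infsum_le_finite_sums l2_summable_UNIV sum_le_of_L2_set_le K)
  moreover have "0 \<le> K" using K[of "{}"] by simp
  ultimately show ?thesis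
    unfolding l2_norm_def by (simp add: real_le_lsqrt)
qed

lemma cmod_le_l2_norm: "f \<in> l2 X \<Longrightarrow> cmod (f x) \<le> l2_norm f"
  using L2_set_le_l2_norm[of f X "{x}"] by simp

lemma L2_set_cmod_add:
  "L2_set (\<lambda>x. cmod (f x + g x)) F \<le> L2_set (\<lambda>x. cmod (f x)) F + L2_set (\<lambda>x. cmod (g x)) F"
  by (rule order_trans[OF L2_set_mono L2_set_triangle_ineq]) (auto intro: norm_triangle_ineq)

lemma L2_set_cmod_add_le:
  assumes "f \<in> l2 X" "g \<in> l2 X"
  shows "L2_set (\<lambda>x. cmod (f x + g x)) F \<le> l2_norm f + l2_norm g"
  by (rule order_trans[OF L2_set_cmod_add add_mono[OF L2_set_le_l2_norm L2_set_le_l2_norm]])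
    (rule assms)+

lemma L2_set_cmod_scale: "L2_set (\<lambda>x. cmod (c * f x)) F = cmod c * L2_set (\<lambda>x. cmod (f x)) F"
  by (simp add: norm_mult L2_set_right_distrib)

lemma l2_add: "f \<in> l2 X \<Longrightarrow> g \<in> l2 X \<Longrightarrow> (\<lambda>x. f x + g x) \<in> l2 X"
  by (rule l2I[OF _ L2_set_cmod_add_le]) (auto simp: l2_outside)

lemma l2_norm_triangle:
  "f \<in> l2 X \<Longrightarrow> g \<in> l2 X \<Longrightarrow> l2_norm (\<lambda>x. f x + g x) \<le> l2_norm f + l2_norm g"
  by (rule l2_norm_leI[OF L2_set_cmod_add_le])

lemma L2_set_cmod_scale_le:
  "f \<in> l2 X \<Longrightarrow> L2_set (\<lambda>x. cmod (c * f x)) F \<le> cmod c * l2_norm f"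
  unfolding L2_set_cmod_scale by (intro mult_left_mono L2_set_le_l2_norm) auto

lemma l2_scale: "f \<in> l2 X \<Longrightarrow> (\<lambda>x. c * f x) \<in> l2 X"
  by (rule l2I[OF _ L2_set_cmod_scale_le]) (auto simp: l2_outside)

lemma l2_norm_scale: "l2_norm (\<lambda>x. c * f x) = cmod c * l2_norm f"
  by (simp add: l2_norm_def norm_mult power_mult_distrib infsum_cmult_right' real_sqrt_mult)

lemma l2_diff: "f \<in> l2 X \<Longrightarrow> g \<in> l2 X \<Longrightarrow> (\<lambda>x. f x - g x) \<in> l2 X"
  using l2_add[of f X "\<lambda>x. - 1 * g x"] l2_scale[of g X "- 1"] by simp

lemma l2_zero: "(\<lambda>x. 0) \<in> l2 X"
  by (simp add: l2_def)

lemma l2_norm_zero [simp]: "l2_norm (\<lambda>x. 0) = 0"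
  by (simp add: l2_norm_def)

lemma l2_norm_eq_0: "f \<in> l2 X \<Longrightarrow> l2_norm f = 0 \<longleftrightarrow> f = (\<lambda>x. 0)"
proof
  assume "f \<in> l2 X" "l2_norm f = 0"
  then show "f = (\<lambda>x. 0)" using cmod_le_l2_norm[of f X] by (auto simp: fun_eq_iff)
qed simp

lemma l2_norm_le_add_diff:
  assumes "f \<in> l2 X" "g \<in> l2 X"
  shows "l2_norm f \<le> l2_norm g + l2_norm (\<lambda>x. f x - g x)"
  using l2_norm_triangle[OF assms(2) l2_diff[OF assms]] by simp

lemma l2_basis_in_l2: "x \<in> X \<Longrightarrow> l2_basis x \<in> l2 X"
proof (rule l2I[where K = 1])
  fix F :: "'a set" assume "finite F"
  have "(\<Sum>y\<in>F. (cmod (l2_basis x y))\<^sup>2) = (\<Sum>y\<in>F. if y = x then 1 else 0)"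
    by (rule sum.cong) (auto simp: l2_basis_def)
  also have "\<dots> \<le> 1" using \<open>finite F\<close> by (simp add: sum.delta)
  finally show "L2_set (\<lambda>y. cmod (l2_basis x y)) F \<le> 1"
    by (simp add: L2_set_def)
qed (auto simp: l2_basis_def)

definition l2_truncate :: "'x set \<Rightarrow> ('x \<Rightarrow> complex) \<Rightarrow> 'x \<Rightarrow> complex" where
  "l2_truncate F f = (\<lambda>x. if x \<in> F then f x else 0)"

lemma l2_truncate_empty: "l2_truncate {} f = (\<lambda>x. 0)"
  by (simp add: l2_truncate_def)

lemma l2_truncate_insert:
  "x \<notin> F \<Longrightarrow> l2_truncate (insert x F) f = (\<lambda>y. f x * l2_basis x y + l2_truncate F f y)"
  by (auto simp: l2_truncate_def l2_basis_def fun_eq_iff)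

lemma L2_set_cmod_truncate:
  assumes "finite G"
  shows "L2_set (\<lambda>x. cmod (l2_truncate F f x)) G = L2_set (\<lambda>x. cmod (f x)) (G \<inter> F)"
proof -
  have "(\<Sum>x\<in>G. (cmod (l2_truncate F f x))\<^sup>2) = (\<Sum>x\<in>G \<inter> F. (cmod (f x))\<^sup>2)"
    unfolding sum.inter_restrict[OF assms] by (rule sum.cong) (auto simp: l2_truncate_def)
  then show ?thesis by (simp add: L2_set_def)
qed

lemma L2_set_cmod_truncate_le:
  "finite F \<Longrightarrow> finite G \<Longrightarrow> L2_set (\<lambda>x. cmod (l2_truncate F f x)) G \<le> L2_set (\<lambda>x. cmod (f x)) F"
  by (simp only: L2_set_cmod_truncate) (unfold L2_set_def, intro real_sqrt_le_mono sum_mono2, auto)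

lemma l2_norm_truncate_le:
  "finite F \<Longrightarrow> l2_norm (l2_truncate F f) \<le> L2_set (\<lambda>x. cmod (f x)) F"
  by (rule l2_norm_leI[OF L2_set_cmod_truncate_le])

lemma l2_truncate_in_l2: "finite F \<Longrightarrow> F \<subseteq> X \<Longrightarrow> l2_truncate F f \<in> l2 X"
  by (rule l2I[OF _ L2_set_cmod_truncate_le]) (auto simp: l2_truncate_def)

text \<open>Identities between bounded functionals can therefore be checked on vectors of finite support.\<close>

lemma l2_truncate_approx:
  assumes f: "f \<in> l2 X" and e: "0 < e"
  shows "\<exists>F. finite F \<and> F \<subseteq> X \<and> l2_norm (\<lambda>x. f x - l2_truncate F f x) \<le> e"
proof -
  let ?q = "\<lambda>x. (cmod (f x))\<^sup>2"
  have sm: "?q summable_on UNIV" by (rule l2_summable_UNIV[OF f])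
  have "\<exists>F. finite F \<and> infsum ?q UNIV - e\<^sup>2 < sum ?q F"
  proof (rule ccontr)
    assume "\<not> ?thesis"
    then have "infsum ?q UNIV \<le> infsum ?q UNIV - e\<^sup>2"
      by (intro infsum_le_finite_sums sm) (auto simp: not_less)
    then show False using e by simp
  qed
  then obtain F where F: "finite F" "infsum ?q UNIV - e\<^sup>2 < sum ?q F" by blast
  have "l2_norm (\<lambda>x. f x - l2_truncate (F \<inter> X) f x) \<le> e"
  proof (rule l2_norm_leI)
    fix G :: "'a set" assume G: "finite G"
    have "(\<Sum>x\<in>G. (cmod (f x - l2_truncate (F \<inter> X) f x))\<^sup>2) = sum ?q (G - F)"
      using G by (intro sum.mono_neutral_cong_right) (auto simp: l2_truncate_def l2_outside[OF f])
    also have "\<dots> = sum ?q (G \<union> F) - sum ?q F"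
      using sum_diff[of "G \<union> F" F ?q] G F(1) by (simp add: Un_Diff)
    also have "\<dots> \<le> infsum ?q UNIV - sum ?q F"
      using G F by (intro diff_right_mono finite_sum_le_infsum sm) auto
    also have "\<dots> \<le> e\<^sup>2" using F by simp
    finally show "L2_set (\<lambda>x. cmod (f x - l2_truncate (F \<inter> X) f x)) G \<le> e"
      using e by (simp add: L2_set_def real_le_lsqrt)
  qed
  then show ?thesis using F by (intro exI[of _ "F \<inter> X"]) auto
qed

lemma sum_cmod_mult_le:
  assumes "f \<in> l2 X" "g \<in> l2 X"
  shows "(\<Sum>x\<in>F. cmod (cnj (f x) * g x)) \<le> l2_norm f * l2_norm g"
proof -
  have "(\<Sum>x\<in>F. cmod (cnj (f x) * g x)) = (\<Sum>x\<in>F. \<bar>cmod (f x)\<bar> * \<bar>cmod (g x)\<bar>)"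
    by (simp add: norm_mult)
  also have "\<dots> \<le> L2_set (\<lambda>x. cmod (f x)) F * L2_set (\<lambda>x. cmod (g x)) F"
    by (rule L2_set_mult_ineq)
  also have "\<dots> \<le> l2_norm f * l2_norm g"
    by (intro mult_mono L2_set_le_l2_norm[OF assms(1)] L2_set_le_l2_norm[OF assms(2)]) auto
  finally show ?thesis .
qed

lemma inner_abs_summable:
  assumes "f \<in> l2 X" "g \<in> l2 X"
  shows "(\<lambda>x. cmod (cnj (f x) * g x)) summable_on UNIV"
  by (intro nonneg_bdd_above_summable_on bdd_aboveI2[where M = "l2_norm f * l2_norm g"]
      sum_cmod_mult_le[OF assms]) auto

lemma inner_summable:
  assumes "f \<in> l2 X" "g \<in> l2 X"
  shows "(\<lambda>x. cnj (f x) * g x) summable_on UNIV"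
  by (rule abs_summable_summable[OF inner_abs_summable[OF assms]])

lemma l2_Cauchy_Schwarz:
  assumes "f \<in> l2 X" "g \<in> l2 X"
  shows "cmod (l2_inner f g) \<le> l2_norm f * l2_norm g"
  unfolding l2_inner_def
  by (rule order_trans[OF norm_infsum_bound[OF inner_abs_summable[OF assms]]])
    (intro infsum_le_finite_sums inner_abs_summable[OF assms] sum_cmod_mult_le[OF assms])

lemma l2_inner_commute: "l2_inner g f = cnj (l2_inner f g)"
  unfolding l2_inner_def infsum_cnj[symmetric] by (simp add: mult.commute)

lemma l2_inner_add_right:
  assumes "f \<in> l2 X" "g \<in> l2 X" "h \<in> l2 X"
  shows "l2_inner f (\<lambda>x. g x + h x) = l2_inner f g + l2_inner f h"
  unfolding l2_inner_def
  using infsum_add[OF inner_summable[OF assms(1,2)] inner_summable[OF assms(1,3)]]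
  by (simp add: ring_distribs)

lemma l2_inner_scale_right: "l2_inner f (\<lambda>x. c * g x) = c * l2_inner f g"
  unfolding l2_inner_def infsum_cmult_right'[symmetric] by (simp add: mult_ac)

lemma l2_inner_add_left:
  assumes "f \<in> l2 X" "g \<in> l2 X" "h \<in> l2 X"
  shows "l2_inner (\<lambda>x. f x + g x) h = l2_inner f h + l2_inner g h"
  using l2_inner_add_right[OF assms(3,1,2)] l2_inner_commute
  by (metis complex_cnj_add)

lemma l2_inner_scale_left: "l2_inner (\<lambda>x. c * f x) g = cnj c * l2_inner f g"
  by (metis complex_cnj_mult l2_inner_commute l2_inner_scale_right)

lemma l2_inner_diff_left:
  assumes "f \<in> l2 X" "g \<in> l2 X" "h \<in> l2 X"
  shows "l2_inner (\<lambda>x. f x - g x) h = l2_inner f h - l2_inner g h"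
  using l2_inner_add_left[OF assms(1) l2_scale[OF assms(2), of "- 1"] assms(3)]
    l2_inner_scale_left[of "- 1" g h] by simp

lemma l2_inner_zero [simp]: "l2_inner (\<lambda>x. 0) g = 0" "l2_inner f (\<lambda>x. 0) = 0"
  by (simp_all add: l2_inner_def)

lemma l2_inner_self:
  assumes "f \<in> l2 X"
  shows "l2_inner f f = complex_of_real ((l2_norm f)\<^sup>2)"
proof -
  note sm = l2_summable_UNIV[OF assms]
  have "l2_inner f f = (\<Sum>\<^sub>\<infinity>x. complex_of_real ((cmod (f x))\<^sup>2))"
    unfolding l2_inner_def by (intro infsum_cong) (simp add: complex_norm_square mult.commute del: of_real_power)
  also have "\<dots> = complex_of_real (\<Sum>\<^sub>\<infinity>x. (cmod (f x))\<^sup>2)"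
    by (rule infsumI[OF has_sum_of_real[OF has_sum_infsum[OF sm]]])
  also have "\<dots> = complex_of_real ((l2_norm f)\<^sup>2)"
    by (simp add: l2_norm_def infsum_nonneg)
  finally show ?thesis .
qed

lemma l2_inner_basis_left: "l2_inner (l2_basis x) f = f x"
proof -
  have "l2_inner (l2_basis x) f = infsum (\<lambda>y. cnj (l2_basis x y) * f y) {x}"
    unfolding l2_inner_def by (rule infsum_cong_neutral) (auto simp: l2_basis_def)
  then show ?thesis by (simp add: l2_basis_def)
qed

lemma l2_inner_truncate:
  "finite F \<Longrightarrow> l2_inner (l2_truncate F f) h = (\<Sum>x\<in>F. cnj (f x) * h x)"
proof -
  assume F: "finite F"
  have "l2_inner (l2_truncate F f) h = infsum (\<lambda>x. cnj (f x) * h x) F"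
    unfolding l2_inner_def by (rule infsum_cong_neutral) (auto simp: l2_truncate_def)
  then show ?thesis using F by simp
qed

lemma l2_inner_left_unique:
  assumes "g \<in> l2 X" "h \<in> l2 X" "\<And>f. f \<in> l2 X \<Longrightarrow> l2_inner f g = l2_inner f h"
  shows "g = h"
proof
  fix x
  show "g x = h x"
  proof (cases "x \<in> X")
    case True
    then show ?thesis
      using assms(3)[OF l2_basis_in_l2] by (simp add: l2_inner_basis_left)
  next
    case False
    then show ?thesis using assms by (simp add: l2_outside)
  qed
qed

section \<open>Bounded operators and their norm\<close>

lemma l2_opI:
  assumes "\<And>f. f \<in> l2 X \<Longrightarrow> T f \<in> l2 Y"
    and "\<And>f. f \<notin> l2 X \<Longrightarrow> T f = undefined"
    and "\<And>f g. f \<in> l2 X \<Longrightarrow> g \<in> l2 X \<Longrightarrow> T (\<lambda>x. f x + g x) = (\<lambda>y. T f y + T g y)"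
    and "\<And>c f. f \<in> l2 X \<Longrightarrow> T (\<lambda>x. c * f x) = (\<lambda>y. c * T f y)"
    and "\<And>f. f \<in> l2 X \<Longrightarrow> l2_norm (T f) \<le> K * l2_norm f"
  shows "T \<in> l2_op X Y"
  unfolding l2_op_def using assms(1-4) by (auto simp: PiE_iff extensional_def intro!: exI[of _ K] assms(5))

lemma l2_op_closed: "T \<in> l2_op X Y \<Longrightarrow> f \<in> l2 X \<Longrightarrow> T f \<in> l2 Y"
  by (auto simp: l2_op_def)

lemma l2_op_undefined: "T \<in> l2_op X Y \<Longrightarrow> f \<notin> l2 X \<Longrightarrow> T f = undefined"
  by (auto simp: l2_op_def)

lemma l2_op_add:
  "T \<in> l2_op X Y \<Longrightarrow> f \<in> l2 X \<Longrightarrow> g \<in> l2 X \<Longrightarrow> T (\<lambda>x. f x + g x) = (\<lambda>y. T f y + T g y)"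
  by (auto simp: l2_op_def)

lemma l2_op_scale:
  "T \<in> l2_op X Y \<Longrightarrow> f \<in> l2 X \<Longrightarrow> T (\<lambda>x. c * f x) = (\<lambda>y. c * T f y)"
  by (auto simp: l2_op_def)

lemma l2_op_diff:
  assumes "T \<in> l2_op X Y" "f \<in> l2 X" "g \<in> l2 X"
  shows "T (\<lambda>x. f x - g x) = (\<lambda>y. T f y - T g y)"
  using l2_op_add[OF assms(1,2) l2_scale[OF assms(3), of "- 1"]] l2_op_scale[OF assms(1,3), of "- 1"]
  by simp

lemma l2_op_zero: "T \<in> l2_op X Y \<Longrightarrow> T (\<lambda>x. 0) = (\<lambda>y. 0)"
  using l2_op_scale[OF _ l2_zero, of T X Y 0] by simp

text \<open>Operators are extensional, so agreement on \<open>l2 X\<close> is equality.\<close>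

lemma l2_op_eqI:
  assumes "S \<in> l2_op X Y" "T \<in> l2_op X Y" "\<And>f. f \<in> l2 X \<Longrightarrow> S f = T f"
  shows "S = T"
  using assms by (metis l2_op_undefined ext)

text \<open>The norm of \<open>l2_op_algebra\<close>, but also for operators between different spaces.\<close>

definition l2_opnorm :: "'x set \<Rightarrow> ('x, 'y) l2_operator \<Rightarrow> real" where
  "l2_opnorm X T = (SUP f\<in>{f \<in> l2 X. l2_norm f \<le> 1}. l2_norm (T f))"

lemma l2_opnorm_bdd:
  assumes "T \<in> l2_op X Y"
  shows "bdd_above ((\<lambda>f. l2_norm (T f)) ` {f \<in> l2 X. l2_norm f \<le> 1})"
proof -
  obtain K where K: "\<forall>f\<in>l2 X. l2_norm (T f) \<le> K * l2_norm f"
    using assms unfolding l2_op_def by blast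
  show ?thesis
  proof (rule bdd_aboveI2)
    fix f assume f: "f \<in> {f \<in> l2 X. l2_norm f \<le> 1}"
    then have "l2_norm (T f) \<le> K * l2_norm f" using K by blast
    also have "\<dots> \<le> \<bar>K\<bar> * 1" using f by (intro mult_mono) auto
    finally show "l2_norm (T f) \<le> \<bar>K\<bar>" by simp
  qed
qed

lemma l2_opnorm_nonneg: "T \<in> l2_op X Y \<Longrightarrow> 0 \<le> l2_opnorm X T"
  unfolding l2_opnorm_def
  by (rule order_trans[OF l2_norm_nonneg cSUP_upper[OF _ l2_opnorm_bdd]]) (auto intro: l2_zero)

lemma l2_norm_le_opnorm:
  assumes T: "T \<in> l2_op X Y" and f: "f \<in> l2 X"
  shows "l2_norm (T f) \<le> l2_opnorm X T * l2_norm f"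
proof (cases "l2_norm f = 0")
  case True
  then have "f = (\<lambda>x. 0)" using l2_norm_eq_0 f by blast
  then show ?thesis using l2_op_zero[OF T] by simp
next
  case False
  then have pos: "0 < l2_norm f" using l2_norm_nonneg[of f] by linarith
  define c where "c = complex_of_real (1 / l2_norm f)"
  have c: "cmod c = 1 / l2_norm f" unfolding c_def norm_of_real using pos by simp
  have "l2_norm (T (\<lambda>x. c * f x)) \<le> l2_opnorm X T"
    unfolding l2_opnorm_def using f pos c
    by (intro cSUP_upper l2_opnorm_bdd[OF T]) (auto simp: l2_norm_scale l2_scale)
  then show ?thesis
    using pos c by (simp add: l2_op_scale[OF T f] l2_norm_scale field_simps)
qed

lemma l2_opnorm_le:
  assumes "0 \<le> K" "\<And>f. f \<in> l2 X \<Longrightarrow> l2_norm (T f) \<le> K * l2_norm f"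
  shows "l2_opnorm X T \<le> K"
  unfolding l2_opnorm_def
proof (rule cSUP_least)
  show "{f \<in> l2 X. l2_norm f \<le> 1} \<noteq> {}" using l2_zero by fastforce
  fix f assume f: "f \<in> {f \<in> l2 X. l2_norm f \<le> 1}"
  then have "l2_norm (T f) \<le> K * l2_norm f" using assms by blast
  also have "\<dots> \<le> K * 1" using f assms by (intro mult_left_mono) auto
  finally show "l2_norm (T f) \<le> K" by simp
qed

lemma l2_norm_compose_le:
  assumes T: "T \<in> l2_op X Y" and S: "S \<in> l2_op Y Z" and f: "f \<in> l2 X"
  shows "l2_norm (compose (l2 X) S T f) \<le> l2_opnorm Y S * l2_opnorm X T * l2_norm f"
proof -
  have "l2_norm (S (T f)) \<le> l2_opnorm Y S * l2_norm (T f)"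
    by (intro l2_norm_le_opnorm[OF S] l2_op_closed[OF T] f)
  also have "\<dots> \<le> l2_opnorm Y S * (l2_opnorm X T * l2_norm f)"
    by (intro mult_left_mono l2_norm_le_opnorm[OF T] f l2_opnorm_nonneg[OF S])
  finally show ?thesis using f by (simp add: compose_def mult.assoc)
qed

lemma l2_op_compose:
  assumes T: "T \<in> l2_op X Y" and S: "S \<in> l2_op Y Z"
  shows "compose (l2 X) S T \<in> l2_op X Z"
  by (rule l2_opI[OF _ _ _ _ l2_norm_compose_le[OF T S]])
    (auto simp: compose_def l2_add l2_scale l2_op_closed[OF T] l2_op_closed[OF S]
      l2_op_add[OF T] l2_op_add[OF S] l2_op_scale[OF T] l2_op_scale[OF S])

lemma l2_norm_sum_le:
  assumes S: "S \<in> l2_op X Y" and T: "T \<in> l2_op X Y" and f: "f \<in> l2 X"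
  shows "l2_norm ((\<lambda>f\<in>l2 X. \<lambda>x. S f x + T f x) f) \<le> (l2_opnorm X S + l2_opnorm X T) * l2_norm f"
proof -
  have "l2_norm (\<lambda>x. S f x + T f x) \<le> l2_norm (S f) + l2_norm (T f)"
    by (rule l2_norm_triangle[OF l2_op_closed[OF S f] l2_op_closed[OF T f]])
  also have "\<dots> \<le> l2_opnorm X S * l2_norm f + l2_opnorm X T * l2_norm f"
    by (intro add_mono l2_norm_le_opnorm[OF S] l2_norm_le_opnorm[OF T] f)
  finally show ?thesis using f by (simp add: distrib_right)
qed

lemma l2_op_sum:
  assumes S: "S \<in> l2_op X Y" and T: "T \<in> l2_op X Y"
  shows "(\<lambda>f\<in>l2 X. \<lambda>x. S f x + T f x) \<in> l2_op X Y"
  by (rule l2_opI[OF _ _ _ _ l2_norm_sum_le[OF S T]])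
    (auto simp: l2_add l2_scale l2_op_closed[OF T] l2_op_closed[OF S]
      l2_op_add[OF T] l2_op_add[OF S] l2_op_scale[OF T] l2_op_scale[OF S] ring_distribs add_ac)

lemma l2_norm_scaled_le:
  assumes T: "T \<in> l2_op X Y" and f: "f \<in> l2 X"
  shows "l2_norm ((\<lambda>f\<in>l2 X. \<lambda>x. c * T f x) f) \<le> cmod c * l2_opnorm X T * l2_norm f"
  using f mult_left_mono[OF l2_norm_le_opnorm[OF T f], of "cmod c"]
  by (simp add: l2_norm_scale mult.assoc)

lemma l2_op_scaled:
  assumes T: "T \<in> l2_op X Y"
  shows "(\<lambda>f\<in>l2 X. \<lambda>x. c * T f x) \<in> l2_op X Y"
  by (rule l2_opI[OF _ _ _ _ l2_norm_scaled_le[OF T]])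
    (auto simp: l2_add l2_scale l2_op_closed[OF T] l2_op_add[OF T] l2_op_scale[OF T]
      ring_distribs mult_ac)

lemma l2_op_id: "(\<lambda>f\<in>l2 X. f) \<in> l2_op X X"
  by (rule l2_opI[where K = 1]) (auto simp: l2_add l2_scale)

lemma l2_op_null: "(\<lambda>f\<in>l2 X. \<lambda>y. 0) \<in> l2_op X Y"
  by (rule l2_opI[where K = 0]) (auto simp: l2_add l2_scale l2_zero)

section \<open>Adjoints\<close>

lemma l2_inner_op_truncate:
  assumes T: "T \<in> l2_op X Y" and g: "g \<in> l2 Y" and "finite F" "F \<subseteq> X"
  shows "l2_inner (T (l2_truncate F f)) g = (\<Sum>x\<in>F. cnj (f x) * l2_inner (T (l2_basis x)) g)"
  using assms(3,4)
proof (induction F)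
  case empty
  then show ?case by (simp add: l2_truncate_empty l2_op_zero[OF T])
next
  case (insert x F)
  have b: "l2_basis x \<in> l2 X" using insert by (intro l2_basis_in_l2) auto
  have F: "l2_truncate F f \<in> l2 X" using insert by (intro l2_truncate_in_l2) auto
  have "T (l2_truncate (insert x F) f) = (\<lambda>y. f x * T (l2_basis x) y + T (l2_truncate F f) y)"
    unfolding l2_truncate_insert[OF insert.hyps(2)]
    by (simp add: l2_op_add[OF T l2_scale[OF b] F] l2_op_scale[OF T b])
  then have "l2_inner (T (l2_truncate (insert x F) f)) g
      = cnj (f x) * l2_inner (T (l2_basis x)) g + l2_inner (T (l2_truncate F f)) g"
    using l2_inner_add_left[OF l2_scale[OF l2_op_closed[OF T b]] l2_op_closed[OF T F] g]
    by (simp add: l2_inner_scale_left)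
  then show ?case using insert by simp
qed

text \<open>The only possible value of the adjoint at \<open>g\<close>: its coordinate at \<open>x\<close> is its inner product with
  the basis vector \<open>e\<^sub>x\<close>, hence the inner product of \<open>T e\<^sub>x\<close> and \<open>g\<close>.\<close>

definition adj_vector :: "'x set \<Rightarrow> ('x, 'y) l2_operator \<Rightarrow> ('y \<Rightarrow> complex) \<Rightarrow> 'x \<Rightarrow> complex" where
  "adj_vector X T g = (\<lambda>x. if x \<in> X then l2_inner (T (l2_basis x)) g else 0)"

text \<open>Let \<open>h\<close> be the vector in question and \<open>L\<close> the norm of its truncation to a finite set.
  Applying \<open>T\<close> to the truncation and pairing with \<open>g\<close> gives \<open>L\<^sup>2\<close>, and by Cauchy-Schwarz at
  most \<open>l2_opnorm X T * L * l2_norm g\<close>; cancel \<open>L\<close>.\<close>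

lemma L2_set_adj_vector:
  assumes T: "T \<in> l2_op X Y" and g: "g \<in> l2 Y" and F: "finite F"
  shows "L2_set (\<lambda>x. cmod (adj_vector X T g x)) F \<le> l2_opnorm X T * l2_norm g"
proof -
  define h where "h = adj_vector X T g"
  define E where "E = F \<inter> X"
  define L where "L = L2_set (\<lambda>x. cmod (h x)) E"
  have E: "finite E" "E \<subseteq> X" using F by (auto simp: E_def)
  have Ein: "l2_truncate E h \<in> l2 X" by (rule l2_truncate_in_l2[OF E])
  have "complex_of_real (L\<^sup>2) = (\<Sum>x\<in>E. cnj (h x) * h x)"
    by (simp add: L_def L2_set_def sum_nonneg of_real_sum complex_norm_square mult.commute
        del: of_real_power)
  also have "\<dots> = l2_inner (T (l2_truncate E h)) g"
    unfolding l2_inner_op_truncate[OF T g E] using E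
    by (intro sum.cong) (auto simp: h_def adj_vector_def)
  finally have "L\<^sup>2 = cmod (l2_inner (T (l2_truncate E h)) g)"
    by (metis abs_of_nonneg norm_of_real zero_le_power2)
  also have "\<dots> \<le> l2_norm (T (l2_truncate E h)) * l2_norm g"
    by (rule l2_Cauchy_Schwarz[OF l2_op_closed[OF T Ein] g])
  also have "\<dots> \<le> l2_opnorm X T * l2_norm (l2_truncate E h) * l2_norm g"
    by (intro mult_right_mono l2_norm_le_opnorm[OF T Ein]) auto
  also have "\<dots> \<le> l2_opnorm X T * L * l2_norm g"
    unfolding L_def
    by (intro mult_right_mono mult_left_mono l2_norm_truncate_le E l2_opnorm_nonneg[OF T]) auto
  finally have "L * L \<le> (l2_opnorm X T * l2_norm g) * L"
    by (simp add: power2_eq_square mult_ac)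
  moreover have "0 \<le> L" by (simp add: L_def)
  ultimately have "L \<le> l2_opnorm X T * l2_norm g"
    using l2_opnorm_nonneg[OF T] by (cases "L = 0") auto
  moreover have "(\<Sum>x\<in>E. (cmod (h x))\<^sup>2) = (\<Sum>x\<in>F. (cmod (h x))\<^sup>2)"
    using F by (intro sum.mono_neutral_left) (auto simp: E_def h_def adj_vector_def)
  ultimately show ?thesis by (simp add: L_def h_def L2_set_def)
qed

lemma adj_vector_in_l2: "T \<in> l2_op X Y \<Longrightarrow> g \<in> l2 Y \<Longrightarrow> adj_vector X T g \<in> l2 X"
  by (rule l2I[OF _ L2_set_adj_vector]) (auto simp: adj_vector_def)

lemma l2_norm_adj_vector:
  "T \<in> l2_op X Y \<Longrightarrow> g \<in> l2 Y \<Longrightarrow> l2_norm (adj_vector X T g) \<le> l2_opnorm X T * l2_norm g"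
  by (rule l2_norm_leI[OF L2_set_adj_vector])

text \<open>Both sides agree when \<open>f\<close> has finite support, by linearity, and both depend continuously on \<open>f\<close>.\<close>

lemma l2_inner_adj_vector:
  assumes T: "T \<in> l2_op X Y" and g: "g \<in> l2 Y" and f: "f \<in> l2 X"
  shows "l2_inner (T f) g = l2_inner f (adj_vector X T g)"
proof -
  define h where "h = adj_vector X T g"
  have h: "h \<in> l2 X" "l2_norm h \<le> l2_opnorm X T * l2_norm g"
    unfolding h_def by (rule adj_vector_in_l2[OF T g] l2_norm_adj_vector[OF T g])+
  \<comment> \<open>Both sides have Lipschitz constant at most \<open>l2_opnorm X T * l2_norm g\<close> in \<open>f\<close>; adding \<open>1\<close> makes
    division by \<open>M\<close> possible.\<close>
  define M where "M = 2 * (l2_opnorm X T * l2_norm g) + 1"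
  have M: "0 < M" using l2_opnorm_nonneg[OF T] by (simp add: M_def add_nonneg_pos)
  have "cmod (l2_inner (T f) g - l2_inner f h) \<le> 0 + e" if e: "0 < e" for e
  proof -
    obtain F where F: "finite F" "F \<subseteq> X" "l2_norm (\<lambda>x. f x - l2_truncate F f x) \<le> e / M"
      using l2_truncate_approx[OF f, of "e / M"] e M by auto
    define t where "t = l2_truncate F f"
    define r where "r = (\<lambda>x. f x - t x)"
    have t: "t \<in> l2 X" unfolding t_def by (rule l2_truncate_in_l2[OF F(1,2)])
    have r: "r \<in> l2 X" unfolding r_def by (rule l2_diff[OF f t])
    have eq: "l2_inner (T t) g = l2_inner t h"
      unfolding t_def l2_inner_op_truncate[OF T g F(1,2)] l2_inner_truncate[OF F(1)]
      using F by (intro sum.cong) (auto simp: h_def adj_vector_def)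
    have "l2_inner (T r) g = l2_inner (T f) g - l2_inner (T t) g"
      unfolding r_def l2_op_diff[OF T f t]
      by (rule l2_inner_diff_left[OF l2_op_closed[OF T f] l2_op_closed[OF T t] g])
    moreover have "l2_inner r h = l2_inner f h - l2_inner t h"
      unfolding r_def by (rule l2_inner_diff_left[OF f t h(1)])
    ultimately have "cmod (l2_inner (T f) g - l2_inner f h) = cmod (l2_inner (T r) g - l2_inner r h)"
      using eq by simp
    also have "\<dots> \<le> cmod (l2_inner (T r) g) + cmod (l2_inner r h)"
      by (rule norm_triangle_ineq4)
    also have "\<dots> \<le> l2_norm (T r) * l2_norm g + l2_norm r * l2_norm h"
      by (intro add_mono l2_Cauchy_Schwarz[OF l2_op_closed[OF T r] g] l2_Cauchy_Schwarz[OF r h(1)])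
    also have "\<dots> \<le> (l2_opnorm X T * l2_norm r) * l2_norm g + l2_norm r * (l2_opnorm X T * l2_norm g)"
      by (intro add_mono mult_right_mono mult_left_mono l2_norm_le_opnorm[OF T r] h) auto
    also have "\<dots> \<le> M * l2_norm r"
      by (simp add: M_def algebra_simps)
    also have "\<dots> \<le> M * (e / M)"
      using M F(3) by (intro mult_left_mono) (auto simp: r_def t_def)
    finally show ?thesis using M by simp
  qed
  then have "cmod (l2_inner (T f) g - l2_inner f h) \<le> 0"
    by (rule field_le_epsilon)
  then show ?thesis by (simp add: h_def)
qed

lemma l2_adj_apply:
  assumes T: "T \<in> l2_op X Y" and g: "g \<in> l2 Y"
  shows "l2_adj X Y T g = adj_vector X T g"
proof -
  have "(THE h. h \<in> l2 X \<and> (\<forall>f\<in>l2 X. l2_inner (T f) g = l2_inner f h)) = adj_vector X T g"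
  proof (rule the_equality)
    show "adj_vector X T g \<in> l2 X \<and> (\<forall>f\<in>l2 X. l2_inner (T f) g = l2_inner f (adj_vector X T g))"
      by (simp add: adj_vector_in_l2[OF T g] l2_inner_adj_vector[OF T g])
    fix h assume h: "h \<in> l2 X \<and> (\<forall>f\<in>l2 X. l2_inner (T f) g = l2_inner f h)"
    then have "h \<in> l2 X" by blast
    then show "h = adj_vector X T g"
      by (rule l2_inner_left_unique[OF _ adj_vector_in_l2[OF T g]])
        (use h in \<open>simp flip: l2_inner_adj_vector[OF T g]\<close>)
  qed
  then show ?thesis using g by (simp add: l2_adj_def)
qed

lemma l2_inner_adj:
  "T \<in> l2_op X Y \<Longrightarrow> f \<in> l2 X \<Longrightarrow> g \<in> l2 Y \<Longrightarrow> l2_inner (T f) g = l2_inner f (l2_adj X Y T g)"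
  by (simp add: l2_adj_apply l2_inner_adj_vector)

lemma l2_norm_adj:
  "T \<in> l2_op X Y \<Longrightarrow> g \<in> l2 Y \<Longrightarrow> l2_norm (l2_adj X Y T g) \<le> l2_opnorm X T * l2_norm g"
  by (simp add: l2_adj_apply l2_norm_adj_vector)

lemma l2_adj_op:
  assumes T: "T \<in> l2_op X Y"
  shows "l2_adj X Y T \<in> l2_op Y X"
proof (rule l2_opI[where K = "l2_opnorm X T"])
  fix f g assume f: "f \<in> l2 Y" and g: "g \<in> l2 Y"
  show "l2_adj X Y T (\<lambda>x. f x + g x) = (\<lambda>y. l2_adj X Y T f y + l2_adj X Y T g y)"
    unfolding l2_adj_apply[OF T f] l2_adj_apply[OF T g] l2_adj_apply[OF T l2_add[OF f g]]
    by (rule ext) (simp add: adj_vector_def l2_inner_add_right[OF l2_op_closed[OF T l2_basis_in_l2] f g])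
next
  fix c f assume f: "f \<in> l2 Y"
  show "l2_adj X Y T (\<lambda>x. c * f x) = (\<lambda>y. c * l2_adj X Y T f y)"
    unfolding l2_adj_apply[OF T f] l2_adj_apply[OF T l2_scale[OF f]]
    by (rule ext) (simp add: adj_vector_def l2_inner_scale_right)
next
  fix g assume g: "g \<in> l2 Y"
  show "l2_adj X Y T g \<in> l2 X" by (simp add: l2_adj_apply[OF T g] adj_vector_in_l2[OF T g])
  show "l2_norm (l2_adj X Y T g) \<le> l2_opnorm X T * l2_norm g" by (rule l2_norm_adj[OF T g])
next
  fix g assume "g \<notin> l2 Y"
  then show "l2_adj X Y T g = undefined" by (simp add: l2_adj_def)
qed

lemma l2_adj_eqI:
  assumes T: "T \<in> l2_op X Y" and S: "S \<in> l2_op Y X"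
    and eq: "\<And>f g. f \<in> l2 X \<Longrightarrow> g \<in> l2 Y \<Longrightarrow> l2_inner (T f) g = l2_inner f (S g)"
  shows "l2_adj X Y T = S"
proof (rule l2_op_eqI[OF l2_adj_op[OF T] S])
  fix g assume g: "g \<in> l2 Y"
  show "l2_adj X Y T g = S g"
    by (rule l2_inner_left_unique[OF l2_op_closed[OF l2_adj_op[OF T] g] l2_op_closed[OF S g]])
      (metis eq g l2_inner_adj[OF T _ g])
qed

lemma l2_adj_adj:
  assumes T: "T \<in> l2_op X Y"
  shows "l2_adj Y X (l2_adj X Y T) = T"
proof (rule l2_adj_eqI[OF l2_adj_op[OF T] T])
  fix f g assume f: "f \<in> l2 Y" and g: "g \<in> l2 X"
  have "l2_inner (l2_adj X Y T f) g = cnj (l2_inner (T g) f)"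
    unfolding l2_inner_adj[OF T g f] by (rule l2_inner_commute)
  also have "\<dots> = l2_inner f (T g)"
    by (rule l2_inner_commute[symmetric])
  finally show "l2_inner (l2_adj X Y T f) g = l2_inner f (T g)" .
qed

lemma l2_adj_compose:
  assumes T: "T \<in> l2_op X Y" and S: "S \<in> l2_op Y Z"
  shows "l2_adj X Z (compose (l2 X) S T) = compose (l2 Z) (l2_adj X Y T) (l2_adj Y Z S)"
  by (rule l2_adj_eqI[OF l2_op_compose[OF T S] l2_op_compose[OF l2_adj_op[OF S] l2_adj_op[OF T]]])
    (simp add: compose_def l2_inner_adj[OF S] l2_inner_adj[OF T] l2_op_closed[OF T]
      l2_op_closed[OF l2_adj_op[OF S]])

text \<open>The adjoint is given by a formula that involves only the images of the basis vectors, and an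
  operator is the adjoint of its adjoint.\<close>

lemma l2_op_eqI_basis:
  assumes S: "S \<in> l2_op X Y" and T: "T \<in> l2_op X Y"
    and eq: "\<And>x. x \<in> X \<Longrightarrow> S (l2_basis x) = T (l2_basis x)"
  shows "S = T"
proof -
  have "adj_vector X S = adj_vector X T"
    using eq by (intro ext) (simp add: adj_vector_def)
  then have "l2_adj X Y S = l2_adj X Y T"
    by (intro l2_op_eqI[OF l2_adj_op[OF S] l2_adj_op[OF T]])
      (simp add: l2_adj_apply[OF S] l2_adj_apply[OF T])
  then show ?thesis by (metis l2_adj_adj[OF S] l2_adj_adj[OF T])
qed

section \<open>The bounded operators form a C*-algebra\<close>

lemma l2_op_algebra_simps:
  "carrier (l2_op_algebra X) = l2_op X X"
  "monoid.mult (l2_op_algebra X) S T = compose (l2 X) S T"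
  "one (l2_op_algebra X) = (\<lambda>f\<in>l2 X. f)"
  "ring.zero (l2_op_algebra X) = (\<lambda>f\<in>l2 X. \<lambda>x. 0)"
  "add (l2_op_algebra X) S T = (\<lambda>f\<in>l2 X. \<lambda>x. S f x + T f x)"
  "smult (l2_op_algebra X) c T = (\<lambda>f\<in>l2 X. \<lambda>x. c * T f x)"
  "adj (l2_op_algebra X) = l2_adj X X"
  "nrm (l2_op_algebra X) T = l2_opnorm X T"
  by (simp_all add: l2_op_algebra_def l2_opnorm_def)

lemma complex_ring_cring: "cring complex_ring"
proof -
  have "\<exists>y. y + x = 0" for x :: complex by (rule exI[of _ "- x"]) simp
  then show ?thesis
    by (intro cringI abelian_groupI comm_monoidI) (auto simp: complex_ring_def algebra_simps)
qed

lemma l2_op_abelian_group: "abelian_group (l2_op_algebra X)"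
proof (rule abelian_groupI)
  fix S assume S: "S \<in> carrier (l2_op_algebra X)"
  then have "(\<lambda>f\<in>l2 X. \<lambda>x. - 1 * S f x) \<in> l2_op X X"
    unfolding l2_op_algebra_simps by (rule l2_op_scaled)
  then show "\<exists>T\<in>carrier (l2_op_algebra X). T \<oplus>\<^bsub>l2_op_algebra X\<^esub> S = \<zero>\<^bsub>l2_op_algebra X\<^esub>"
    unfolding l2_op_algebra_simps by (rule bexI[rotated]) (auto intro!: restrict_ext)
next
  fix S assume S: "S \<in> carrier (l2_op_algebra X)"
  then have S: "S \<in> l2_op X X" by (simp add: l2_op_algebra_simps)
  show "\<zero>\<^bsub>l2_op_algebra X\<^esub> \<oplus>\<^bsub>l2_op_algebra X\<^esub> S = S"
    unfolding l2_op_algebra_simps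
    by (rule l2_op_eqI[OF l2_op_sum[OF l2_op_null S] S]) simp
qed (auto simp: l2_op_algebra_simps l2_op_sum l2_op_null add_ac intro!: restrict_ext)

text \<open>Subtraction in the algebra is defined through the additive inverse in a group; completeness is
  stated with it and proved pointwise.\<close>

lemma l2_op_minus:
  assumes S: "S \<in> l2_op X X" and T: "T \<in> l2_op X X"
  shows "S \<ominus>\<^bsub>l2_op_algebra X\<^esub> T = (\<lambda>f\<in>l2 X. \<lambda>x. S f x - T f x)"
proof -
  interpret abelian_group "l2_op_algebra X" by (rule l2_op_abelian_group)
  have "\<ominus>\<^bsub>l2_op_algebra X\<^esub> T = (\<lambda>f\<in>l2 X. \<lambda>x. - 1 * T f x)"
  proof (rule minus_equality)
    show "(\<lambda>f\<in>l2 X. \<lambda>x. - 1 * T f x) \<oplus>\<^bsub>l2_op_algebra X\<^esub> T = \<zero>\<^bsub>l2_op_algebra X\<^esub>"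
      unfolding l2_op_algebra_simps by (auto intro!: restrict_ext)
  qed (use T l2_op_scaled[OF T, of "- 1"] in \<open>simp_all only: l2_op_algebra_simps\<close>)
  then show ?thesis
    unfolding a_minus_def by (auto simp: l2_op_algebra_simps intro!: restrict_ext)
qed

lemma l2_op_ring: "ring (l2_op_algebra X)"
proof (rule ringI)
  show "monoid (l2_op_algebra X)"
  proof (rule monoidI)
    fix S T U assume "S \<in> carrier (l2_op_algebra X)" "T \<in> carrier (l2_op_algebra X)"
      "U \<in> carrier (l2_op_algebra X)"
    then have "U \<in> l2_op X X" by (simp add: l2_op_algebra_simps)
    then show "S \<otimes>\<^bsub>l2_op_algebra X\<^esub> T \<otimes>\<^bsub>l2_op_algebra X\<^esub> U
        = S \<otimes>\<^bsub>l2_op_algebra X\<^esub> (T \<otimes>\<^bsub>l2_op_algebra X\<^esub> U)"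
      by (auto simp: l2_op_algebra_simps compose_def l2_op_closed intro!: restrict_ext)
  next
    fix S assume "S \<in> carrier (l2_op_algebra X)"
    then have S: "S \<in> l2_op X X" by (simp add: l2_op_algebra_simps)
    show "\<one>\<^bsub>l2_op_algebra X\<^esub> \<otimes>\<^bsub>l2_op_algebra X\<^esub> S = S"
      unfolding l2_op_algebra_simps
      by (rule l2_op_eqI[OF l2_op_compose[OF S l2_op_id] S]) (simp add: compose_def l2_op_closed[OF S])
    show "S \<otimes>\<^bsub>l2_op_algebra X\<^esub> \<one>\<^bsub>l2_op_algebra X\<^esub> = S"
      unfolding l2_op_algebra_simps
      by (rule l2_op_eqI[OF l2_op_compose[OF l2_op_id S] S]) (simp add: compose_def)
  qed (auto simp: l2_op_algebra_simps l2_op_compose l2_op_id)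
next
  fix S T U assume "S \<in> carrier (l2_op_algebra X)" "T \<in> carrier (l2_op_algebra X)"
    "U \<in> carrier (l2_op_algebra X)"
  then have S: "S \<in> l2_op X X" and T: "T \<in> l2_op X X" and U: "U \<in> l2_op X X"
    by (simp_all add: l2_op_algebra_simps)
  show "(S \<oplus>\<^bsub>l2_op_algebra X\<^esub> T) \<otimes>\<^bsub>l2_op_algebra X\<^esub> U
      = S \<otimes>\<^bsub>l2_op_algebra X\<^esub> U \<oplus>\<^bsub>l2_op_algebra X\<^esub> T \<otimes>\<^bsub>l2_op_algebra X\<^esub> U"
    unfolding l2_op_algebra_simps compose_def
    by (rule restrict_ext) (simp add: l2_op_closed[OF U])
  show "U \<otimes>\<^bsub>l2_op_algebra X\<^esub> (S \<oplus>\<^bsub>l2_op_algebra X\<^esub> T)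
      = U \<otimes>\<^bsub>l2_op_algebra X\<^esub> S \<oplus>\<^bsub>l2_op_algebra X\<^esub> U \<otimes>\<^bsub>l2_op_algebra X\<^esub> T"
    unfolding l2_op_algebra_simps compose_def
    by (rule restrict_ext) (simp add: l2_op_closed[OF S] l2_op_closed[OF T] l2_op_add[OF U])
qed (rule l2_op_abelian_group)

lemma l2_op_module: "module complex_ring (l2_op_algebra X)"
proof (rule moduleI)
  fix S assume "S \<in> carrier (l2_op_algebra X)"
  then have S: "S \<in> l2_op X X" by (simp add: l2_op_algebra_simps)
  show "\<one>\<^bsub>complex_ring\<^esub> \<odot>\<^bsub>l2_op_algebra X\<^esub> S = S"
    unfolding l2_op_algebra_simps
    by (rule l2_op_eqI[OF l2_op_scaled[OF S] S]) (simp add: complex_ring_def)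
qed (auto simp: l2_op_algebra_simps l2_op_scaled complex_ring_def ring_distribs mult.assoc
    intro!: restrict_ext complex_ring_cring[unfolded complex_ring_def] l2_op_abelian_group)

lemma l2_opnorm_adj_le:
  "T \<in> l2_op X Y \<Longrightarrow> l2_opnorm Y (l2_adj X Y T) \<le> l2_opnorm X T"
  by (rule l2_opnorm_le[OF l2_opnorm_nonneg l2_norm_adj])

lemma l2_opnorm_compose:
  assumes T: "T \<in> l2_op X Y" and S: "S \<in> l2_op Y Z"
  shows "l2_opnorm X (compose (l2 X) S T) \<le> l2_opnorm Y S * l2_opnorm X T"
  by (rule l2_opnorm_le[OF _ l2_norm_compose_le[OF T S]])
    (intro mult_nonneg_nonneg l2_opnorm_nonneg[OF S] l2_opnorm_nonneg[OF T])

text \<open>The inequality from below rests on \<open>\<parallel>T f\<parallel>\<^sup>2 = \<langle>f, T\<^sup>* T f\<rangle>\<close> and Cauchy-Schwarz.\<close>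

lemma l2_opnorm_cstar_identity:
  assumes T: "T \<in> l2_op X Y"
  shows "l2_opnorm X (compose (l2 X) (l2_adj X Y T) T) = (l2_opnorm X T)\<^sup>2"
proof (rule antisym)
  let ?C = "compose (l2 X) (l2_adj X Y T) T"
  have C: "?C \<in> l2_op X X" by (rule l2_op_compose[OF T l2_adj_op[OF T]])
  have "l2_opnorm X ?C \<le> l2_opnorm Y (l2_adj X Y T) * l2_opnorm X T"
    by (rule l2_opnorm_compose[OF T l2_adj_op[OF T]])
  also have "\<dots> \<le> l2_opnorm X T * l2_opnorm X T"
    by (intro mult_right_mono l2_opnorm_adj_le[OF T] l2_opnorm_nonneg[OF T])
  finally show "l2_opnorm X ?C \<le> (l2_opnorm X T)\<^sup>2" by (simp add: power2_eq_square)
  have "l2_opnorm X T \<le> sqrt (l2_opnorm X ?C)"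
  proof (rule l2_opnorm_le)
    fix f assume f: "f \<in> l2 X"
    have "complex_of_real ((l2_norm (T f))\<^sup>2) = l2_inner f (?C f)"
      unfolding l2_inner_self[OF l2_op_closed[OF T f], symmetric]
        l2_inner_adj[OF T f l2_op_closed[OF T f]]
      using f by (simp add: compose_def)
    then have "(l2_norm (T f))\<^sup>2 = cmod (l2_inner f (?C f))"
      by (metis abs_of_nonneg norm_of_real zero_le_power2)
    also have "\<dots> \<le> l2_norm f * (l2_opnorm X ?C * l2_norm f)"
      by (rule order_trans[OF l2_Cauchy_Schwarz[OF f l2_op_closed[OF C f]]])
        (intro mult_left_mono l2_norm_le_opnorm[OF C f] l2_norm_nonneg)
    also have "\<dots> = (sqrt (l2_opnorm X ?C) * l2_norm f)\<^sup>2"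
      by (simp add: power_mult_distrib l2_opnorm_nonneg[OF C] power2_eq_square)
    finally show "l2_norm (T f) \<le> sqrt (l2_opnorm X ?C) * l2_norm f"
      by (rule power2_le_imp_le) (simp add: l2_opnorm_nonneg[OF C])
  qed (simp add: l2_opnorm_nonneg[OF C])
  then have "(l2_opnorm X T)\<^sup>2 \<le> (sqrt (l2_opnorm X ?C))\<^sup>2"
    by (intro power_mono l2_opnorm_nonneg[OF T])
  then show "(l2_opnorm X T)\<^sup>2 \<le> l2_opnorm X ?C"
    by (simp add: l2_opnorm_nonneg[OF C])
qed

text \<open>The difference \<open>S - T\<close> for operators between different spaces, where \<open>l2_op_algebra\<close> provides none.\<close>

definition op_diff :: "'x set \<Rightarrow> ('x, 'y) l2_operator \<Rightarrow> ('x, 'y) l2_operator \<Rightarrow> ('x, 'y) l2_operator" where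
  "op_diff X S T = (\<lambda>f\<in>l2 X. \<lambda>y. S f y - T f y)"

lemma op_diff_in_l2_op:
  assumes "S \<in> l2_op X Y" "T \<in> l2_op X Y"
  shows "op_diff X S T \<in> l2_op X Y"
proof -
  have "op_diff X S T = (\<lambda>f\<in>l2 X. \<lambda>y. S f y + (\<lambda>f\<in>l2 X. \<lambda>y. - 1 * T f y) f y)"
    unfolding op_diff_def by (rule restrict_ext) simp
  then show ?thesis using l2_op_sum[OF assms(1) l2_op_scaled[OF assms(2)]] by metis
qed

text \<open>The limit operator is the coordinatewise limit. The norm bounds are obtained on finite sets of
  coordinates, where the limit can be taken term by term; this also makes \<open>T n - S\<close>, and
  hence \<open>S\<close>, map into \<open>l2 Y\<close>.\<close>

lemma l2_op_complete:
  assumes T: "\<And>n. T n \<in> l2_op X Y"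
    and Cauchy: "\<And>e. e > 0 \<Longrightarrow> \<exists>N. \<forall>m\<ge>N. \<forall>n\<ge>N. l2_opnorm X (op_diff X (T m) (T n)) < e"
  shows "\<exists>S\<in>l2_op X Y. (\<lambda>n. l2_opnorm X (op_diff X (T n) S)) \<longlonglongrightarrow> 0"
proof -
  have bound: "l2_norm (\<lambda>y. T m f y - T n f y) \<le> l2_opnorm X (op_diff X (T m) (T n)) * l2_norm f"
    if "f \<in> l2 X" for m n f
    using l2_norm_le_opnorm[OF op_diff_in_l2_op[OF T T] that] that by (simp add: op_diff_def)
  have conv: "convergent (\<lambda>n. T n f y)" if f: "f \<in> l2 X" for f y
  proof (rule Cauchy_convergent, rule metric_CauchyI)
    fix e :: real assume e: "0 < e"
    \<comment> \<open>Scaling by \<open>l2_norm f + 1\<close> instead of \<open>l2_norm f\<close> covers the zero vector.\<close>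
    have K: "0 < l2_norm f + 1" using l2_norm_nonneg[of f] by linarith
    obtain N where N: "\<And>m n. m \<ge> N \<Longrightarrow> n \<ge> N \<Longrightarrow> l2_opnorm X (op_diff X (T m) (T n)) < e / (l2_norm f + 1)"
      using Cauchy[of "e / (l2_norm f + 1)"] e K by auto
    show "\<exists>M. \<forall>m\<ge>M. \<forall>n\<ge>M. dist (T m f y) (T n f y) < e"
    proof (intro exI allI impI)
      fix m n assume "N \<le> m" "N \<le> n"
      have "dist (T m f y) (T n f y) \<le> l2_norm (\<lambda>y. T m f y - T n f y)"
        using cmod_le_l2_norm[OF l2_diff[OF l2_op_closed[OF T f] l2_op_closed[OF T f]]]
        by (simp add: dist_norm)
      also have "\<dots> \<le> l2_opnorm X (op_diff X (T m) (T n)) * l2_norm f" by (rule bound[OF f])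
      also have "\<dots> \<le> l2_opnorm X (op_diff X (T m) (T n)) * (l2_norm f + 1)"
        by (intro mult_left_mono l2_opnorm_nonneg[OF op_diff_in_l2_op[OF T T]]) simp
      also have "\<dots> < e / (l2_norm f + 1) * (l2_norm f + 1)"
        by (rule mult_strict_right_mono[OF N[OF \<open>N \<le> m\<close> \<open>N \<le> n\<close>] K])
      also have "\<dots> = e" using K by simp
      finally show "dist (T m f y) (T n f y) < e" .
    qed
  qed
  define S where "S = (\<lambda>f\<in>l2 X. \<lambda>y. lim (\<lambda>n. T n f y))"
  have lim: "(\<lambda>n. T n f y) \<longlonglongrightarrow> S f y" if "f \<in> l2 X" for f y
    using conv[OF that, of y] that by (simp add: S_def convergent_LIMSEQ_iff)
  have close: "L2_set (\<lambda>y. cmod (T m f y - S f y)) F \<le> e * l2_norm f"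
    if N: "\<forall>m\<ge>N. \<forall>n\<ge>N. l2_opnorm X (op_diff X (T m) (T n)) < e" and m: "N \<le> m" and f: "f \<in> l2 X"
    for N e m f F
  proof (rule LIMSEQ_le_const2)
    show "(\<lambda>n. L2_set (\<lambda>y. cmod (T m f y - T n f y)) F) \<longlonglongrightarrow> L2_set (\<lambda>y. cmod (T m f y - S f y)) F"
      unfolding L2_set_def by (intro tendsto_intros lim[OF f])
    show "\<exists>M. \<forall>n\<ge>M. L2_set (\<lambda>y. cmod (T m f y - T n f y)) F \<le> e * l2_norm f"
    proof (intro exI allI impI)
      fix n assume n: "N \<le> n"
      have "L2_set (\<lambda>y. cmod (T m f y - T n f y)) F \<le> l2_norm (\<lambda>y. T m f y - T n f y)"
        by (rule L2_set_le_l2_norm[OF l2_diff[OF l2_op_closed[OF T f] l2_op_closed[OF T f]]])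
      also have "\<dots> \<le> l2_opnorm X (op_diff X (T m) (T n)) * l2_norm f" by (rule bound[OF f])
      also have "\<dots> \<le> e * l2_norm f"
        using N m n by (intro mult_right_mono) (auto intro: less_imp_le)
      finally show "L2_set (\<lambda>y. cmod (T m f y - T n f y)) F \<le> e * l2_norm f" .
    qed
  qed
  obtain N1 where N1: "\<forall>m\<ge>N1. \<forall>n\<ge>N1. l2_opnorm X (op_diff X (T m) (T n)) < 1"
    using Cauchy[of 1] by auto
  have outside: "S f y = 0" if "f \<in> l2 X" "y \<notin> Y" for f y
    using LIMSEQ_unique[OF lim[OF that(1), of y], of 0] l2_outside[OF l2_op_closed[OF T that(1)] that(2)]
    by simp
  have diff_in: "(\<lambda>y. T N1 f y - S f y) \<in> l2 Y" if f: "f \<in> l2 X" for f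
    by (rule l2I[OF _ close[OF N1 order_refl f]])
      (simp add: outside[OF f] l2_outside[OF l2_op_closed[OF T f]])
  have S_in: "S f \<in> l2 Y" if f: "f \<in> l2 X" for f
    using l2_diff[OF l2_op_closed[OF T[of N1] f] diff_in[OF f]] by simp
  have S: "S \<in> l2_op X Y"
  proof (rule l2_opI[where K = "l2_opnorm X (T N1) + 1"])
    fix f g assume f: "f \<in> l2 X" and g: "g \<in> l2 X"
    show "S (\<lambda>x. f x + g x) = (\<lambda>y. S f y + S g y)"
    proof
      fix y
      have "(\<lambda>n. T n (\<lambda>x. f x + g x) y) \<longlonglongrightarrow> S f y + S g y"
        unfolding l2_op_add[OF T f g] by (intro tendsto_add lim f g)
      then show "S (\<lambda>x. f x + g x) y = S f y + S g y"
        by (rule LIMSEQ_unique[OF lim[OF l2_add[OF f g]]])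
    qed
  next
    fix c f assume f: "f \<in> l2 X"
    show "S (\<lambda>x. c * f x) = (\<lambda>y. c * S f y)"
    proof
      fix y
      have "(\<lambda>n. T n (\<lambda>x. c * f x) y) \<longlonglongrightarrow> c * S f y"
        unfolding l2_op_scale[OF T f] by (intro tendsto_mult tendsto_const lim f)
      then show "S (\<lambda>x. c * f x) y = c * S f y"
        by (rule LIMSEQ_unique[OF lim[OF l2_scale[OF f]]])
    qed
  next
    fix f assume f: "f \<in> l2 X"
    have "l2_norm (\<lambda>y. S f y - T N1 f y) = l2_norm (\<lambda>y. T N1 f y - S f y)"
      by (simp add: l2_norm_def norm_minus_commute)
    also have "\<dots> \<le> 1 * l2_norm f"
      by (rule l2_norm_leI[OF close[OF N1 order_refl f]])
    finally have "l2_norm (S f) \<le> l2_norm (T N1 f) + l2_norm f"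
      using l2_norm_le_add_diff[OF S_in[OF f] l2_op_closed[OF T[of N1] f]] by simp
    then show "l2_norm (S f) \<le> (l2_opnorm X (T N1) + 1) * l2_norm f"
      using l2_norm_le_opnorm[OF T f, of N1] by (simp add: distrib_right)
  qed (use S_in in \<open>auto simp: S_def\<close>)
  have "(\<lambda>n. l2_opnorm X (op_diff X (T n) S)) \<longlonglongrightarrow> 0"
  proof (rule LIMSEQ_I)
    fix e :: real assume e: "0 < e"
    obtain N where N: "\<forall>m\<ge>N. \<forall>n\<ge>N. l2_opnorm X (op_diff X (T m) (T n)) < e / 2"
      using Cauchy[of "e / 2"] e by auto
    have "l2_opnorm X (op_diff X (T m) S) \<le> e / 2" if m: "N \<le> m" for m
    proof (rule l2_opnorm_le)
      fix f assume f: "f \<in> l2 X"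
      show "l2_norm (op_diff X (T m) S f) \<le> e / 2 * l2_norm f"
        using l2_norm_leI[OF close[OF N m f]] f by (simp add: op_diff_def)
    qed (use e in simp)
    then show "\<exists>M. \<forall>n\<ge>M. norm (l2_opnorm X (op_diff X (T n) S) - 0) < e"
      using e l2_opnorm_nonneg[OF op_diff_in_l2_op[OF T S]]
      by (intro exI[of _ N]) (fastforce intro: le_less_trans)
  qed
  then show ?thesis using S by blast
qed

lemma l2_opnorm_eq_0:
  assumes T: "T \<in> l2_op X Y"
  shows "l2_opnorm X T = 0 \<longleftrightarrow> T = (\<lambda>f\<in>l2 X. \<lambda>y. 0)"
proof
  assume 0: "l2_opnorm X T = 0"
  show "T = (\<lambda>f\<in>l2 X. \<lambda>y. 0)"
  proof (rule l2_op_eqI[OF T l2_op_null])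
    fix f assume f: "f \<in> l2 X"
    have "l2_norm (T f) = 0"
      using l2_norm_le_opnorm[OF T f] l2_norm_nonneg[of "T f"] 0 by simp
    then show "T f = (\<lambda>f\<in>l2 X. \<lambda>y. 0) f"
      using l2_norm_eq_0[OF l2_op_closed[OF T f]] f by simp
  qed
next
  assume 0: "T = (\<lambda>f\<in>l2 X. \<lambda>y. 0)"
  have "l2_opnorm X T \<le> 0" unfolding 0 by (rule l2_opnorm_le) auto
  then show "l2_opnorm X T = 0" using l2_opnorm_nonneg[OF T] by simp
qed

text \<open>The inequality \<open>\<le>\<close> for all scalars gives equality when it is applied to \<open>c\<close> and to its inverse.\<close>

lemma l2_opnorm_scaled:
  assumes T: "T \<in> l2_op X Y"
  shows "l2_opnorm X (\<lambda>f\<in>l2 X. \<lambda>y. c * T f y) = cmod c * l2_opnorm X T"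
proof -
  have le: "l2_opnorm X (\<lambda>f\<in>l2 X. \<lambda>y. c * T f y) \<le> cmod c * l2_opnorm X T"
    if T: "T \<in> l2_op X Y" for c and T :: "('a, 'b) l2_operator"
    by (rule l2_opnorm_le[OF _ l2_norm_scaled_le[OF T]]) (simp_all add: l2_opnorm_nonneg[OF T])
  show ?thesis
  proof (cases "c = 0")
    case True
    then show ?thesis using l2_opnorm_eq_0[OF l2_op_scaled[OF T, of c]] by simp
  next
    case False
    let ?U = "\<lambda>f\<in>l2 X. \<lambda>y. c * T f y"
    have "(\<lambda>f\<in>l2 X. \<lambda>y. inverse c * ?U f y) = T"
      by (rule l2_op_eqI[OF l2_op_scaled[OF l2_op_scaled[OF T]] T]) (simp add: False flip: mult.assoc)
    then have "l2_opnorm X T \<le> cmod (inverse c) * l2_opnorm X ?U"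
      using le[OF l2_op_scaled[OF T, of c], of "inverse c"] by simp
    then have "cmod c * l2_opnorm X T \<le> l2_opnorm X ?U"
      using False unfolding norm_inverse by (simp add: field_simps del: norm_inverse)
    then show ?thesis using le[OF T, of c] by simp
  qed
qed

lemma l2_opnorm_triangle:
  assumes S: "S \<in> l2_op X Y" and T: "T \<in> l2_op X Y"
  shows "l2_opnorm X (\<lambda>f\<in>l2 X. \<lambda>x. S f x + T f x) \<le> l2_opnorm X S + l2_opnorm X T"
  by (rule l2_opnorm_le[OF _ l2_norm_sum_le[OF S T]])
    (simp_all add: l2_opnorm_nonneg[OF S] l2_opnorm_nonneg[OF T])

lemma l2_adj_sum:
  assumes S: "S \<in> l2_op X Y" and T: "T \<in> l2_op X Y"
  shows "l2_adj X Y (\<lambda>f\<in>l2 X. \<lambda>x. S f x + T f x) = (\<lambda>g\<in>l2 Y. \<lambda>x. l2_adj X Y S g x + l2_adj X Y T g x)"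
proof (rule l2_adj_eqI[OF l2_op_sum[OF S T] l2_op_sum[OF l2_adj_op[OF S] l2_adj_op[OF T]]])
  fix f g assume f: "f \<in> l2 X" and g: "g \<in> l2 Y"
  show "l2_inner ((\<lambda>f\<in>l2 X. \<lambda>x. S f x + T f x) f) g
      = l2_inner f ((\<lambda>g\<in>l2 Y. \<lambda>x. l2_adj X Y S g x + l2_adj X Y T g x) g)"
    using f g by (simp add: l2_inner_add_left[OF l2_op_closed[OF S f] l2_op_closed[OF T f] g]
      l2_inner_add_right[OF f l2_op_closed[OF l2_adj_op[OF S] g] l2_op_closed[OF l2_adj_op[OF T] g]]
      l2_inner_adj[OF S] l2_inner_adj[OF T])
qed

lemma l2_adj_scaled:
  assumes T: "T \<in> l2_op X Y"
  shows "l2_adj X Y (\<lambda>f\<in>l2 X. \<lambda>x. c * T f x) = (\<lambda>g\<in>l2 Y. \<lambda>x. cnj c * l2_adj X Y T g x)"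
  by (rule l2_adj_eqI[OF l2_op_scaled[OF T] l2_op_scaled[OF l2_adj_op[OF T]]])
    (simp add: l2_inner_scale_left l2_inner_scale_right l2_inner_adj[OF T])

theorem l2_op_unital_cstar_algebra: "unital_cstar_algebra (l2_op_algebra X)"
proof (intro unital_cstar_algebra.intro l2_op_module l2_op_ring unital_cstar_algebra_axioms.intro)
  fix T :: "nat \<Rightarrow> ('a, 'a) l2_operator"
  assume "\<And>n. T n \<in> carrier (l2_op_algebra X)"
    and C: "\<And>e. 0 < e \<Longrightarrow> \<exists>N. \<forall>m\<ge>N. \<forall>n\<ge>N. nrm (l2_op_algebra X) (T m \<ominus>\<^bsub>l2_op_algebra X\<^esub> T n) < e"
  then have T: "\<And>n. T n \<in> l2_op X X" by (simp add: l2_op_algebra_simps)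
  have "\<exists>S\<in>l2_op X X. (\<lambda>n. l2_opnorm X (op_diff X (T n) S)) \<longlonglongrightarrow> 0"
    by (rule l2_op_complete[OF T]) (use C in \<open>simp add: l2_op_algebra_simps l2_op_minus[OF T T] op_diff_def\<close>)
  then show "\<exists>S\<in>carrier (l2_op_algebra X). (\<lambda>n. nrm (l2_op_algebra X) (T n \<ominus>\<^bsub>l2_op_algebra X\<^esub> S)) \<longlonglongrightarrow> 0"
    by (auto simp: l2_op_algebra_simps l2_op_minus[OF T] op_diff_def)
next
  fix S T c assume "S \<in> carrier (l2_op_algebra X)" "T \<in> carrier (l2_op_algebra X)"
  then have S: "S \<in> l2_op X X" and T: "T \<in> l2_op X X" by (simp_all add: l2_op_algebra_simps)
  show "c \<odot>\<^bsub>l2_op_algebra X\<^esub> S \<otimes>\<^bsub>l2_op_algebra X\<^esub> T = c \<odot>\<^bsub>l2_op_algebra X\<^esub> (S \<otimes>\<^bsub>l2_op_algebra X\<^esub> T)"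
    unfolding l2_op_algebra_simps compose_def by (rule restrict_ext) (simp add: l2_op_closed[OF T])
  show "S \<otimes>\<^bsub>l2_op_algebra X\<^esub> (c \<odot>\<^bsub>l2_op_algebra X\<^esub> T) = c \<odot>\<^bsub>l2_op_algebra X\<^esub> (S \<otimes>\<^bsub>l2_op_algebra X\<^esub> T)"
    unfolding l2_op_algebra_simps compose_def
    by (rule restrict_ext) (simp add: l2_op_scale[OF S l2_op_closed[OF T]])
qed (simp_all add: l2_op_algebra_simps l2_adj_op l2_adj_adj l2_adj_sum l2_adj_scaled l2_adj_compose
    l2_opnorm_nonneg l2_opnorm_eq_0 l2_opnorm_triangle l2_opnorm_scaled l2_opnorm_compose
    l2_opnorm_cstar_identity)

section \<open>*-homomorphisms out of the Cuntz algebra\<close>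

lemma star_hom_closed: "star_hom A B \<phi> \<Longrightarrow> x \<in> carrier A \<Longrightarrow> \<phi> x \<in> carrier B"
  by (auto simp: star_hom_def)

lemma star_hom_zero:
  assumes "unital_cstar_algebra A" "unital_cstar_algebra B" "star_hom A B \<phi>"
  shows "\<phi> \<zero>\<^bsub>A\<^esub> = \<zero>\<^bsub>B\<^esub>"
proof -
  interpret A: unital_cstar_algebra A by fact
  interpret B: unital_cstar_algebra B by fact
  have "\<phi> \<zero>\<^bsub>A\<^esub> = \<phi> (\<zero>\<^bsub>A\<^esub> \<oplus>\<^bsub>A\<^esub> \<zero>\<^bsub>A\<^esub>)" by simp
  also have "\<dots> = \<phi> \<zero>\<^bsub>A\<^esub> \<oplus>\<^bsub>B\<^esub> \<phi> \<zero>\<^bsub>A\<^esub>"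
    using assms(3) A.zero_closed unfolding star_hom_def by blast
  finally show ?thesis
    using B.add.l_cancel_one star_hom_closed[OF assms(3) A.zero_closed] by metis
qed

lemma star_hom_minus:
  assumes "unital_cstar_algebra A" "unital_cstar_algebra B" "star_hom A B \<phi>"
    and x: "x \<in> carrier A" and y: "y \<in> carrier A"
  shows "\<phi> (x \<ominus>\<^bsub>A\<^esub> y) = \<phi> x \<ominus>\<^bsub>B\<^esub> \<phi> y"
proof -
  interpret A: unital_cstar_algebra A by fact
  interpret B: unital_cstar_algebra B by fact
  have add: "\<And>u v. u \<in> carrier A \<Longrightarrow> v \<in> carrier A \<Longrightarrow> \<phi> (u \<oplus>\<^bsub>A\<^esub> v) = \<phi> u \<oplus>\<^bsub>B\<^esub> \<phi> v"
    using assms(3) by (simp add: star_hom_def)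
  note cl = star_hom_closed[OF assms(3)]
  have ny: "\<ominus>\<^bsub>A\<^esub> y \<in> carrier A" using y by (rule A.a_inv_closed)
  have "\<phi> (\<ominus>\<^bsub>A\<^esub> y) \<oplus>\<^bsub>B\<^esub> \<phi> y = \<phi> (\<ominus>\<^bsub>A\<^esub> y \<oplus>\<^bsub>A\<^esub> y)" using add[OF ny y] by simp
  also have "\<dots> = \<zero>\<^bsub>B\<^esub>" using A.l_neg[OF y] star_hom_zero[OF assms(1-3)] by simp
  finally have "\<ominus>\<^bsub>B\<^esub> \<phi> y = \<phi> (\<ominus>\<^bsub>A\<^esub> y)"
    by (rule B.minus_equality) (intro cl y ny)+
  then show ?thesis using add[OF x ny] by (simp add: a_minus_def)
qed

lemma star_hom_finsum:
  assumes "unital_cstar_algebra A" "unital_cstar_algebra B" "star_hom A B \<phi>"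
    and "finite I" "\<And>i. i \<in> I \<Longrightarrow> x i \<in> carrier A"
  shows "\<phi> (\<Oplus>\<^bsub>A\<^esub>i\<in>I. x i) = (\<Oplus>\<^bsub>B\<^esub>i\<in>I. \<phi> (x i))"
proof -
  interpret A: unital_cstar_algebra A by fact
  interpret B: unital_cstar_algebra B by fact
  show ?thesis
    using assms(4,5)
  proof (induction I)
    case empty
    then show ?case using star_hom_zero[OF assms(1-3)] by simp
  next
    case (insert i I)
    have x: "x i \<in> carrier A" "x \<in> I \<rightarrow> carrier A" using insert by auto
    then have px: "\<phi> (x i) \<in> carrier B" "(\<lambda>i. \<phi> (x i)) \<in> I \<rightarrow> carrier B"
      using star_hom_closed[OF assms(3)] by auto
    have "\<phi> (x i \<oplus>\<^bsub>A\<^esub> (\<Oplus>\<^bsub>A\<^esub>i\<in>I. x i)) = \<phi> (x i) \<oplus>\<^bsub>B\<^esub> \<phi> (\<Oplus>\<^bsub>A\<^esub>i\<in>I. x i)"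
      using assms(3) x A.finsum_closed[OF x(2)] by (simp add: star_hom_def)
    then show ?case
      using insert x px by (simp add: A.finsum_insert B.finsum_insert)
  qed
qed

lemma star_hom_cuntz_family:
  assumes "unital_cstar_algebra A" "unital_cstar_algebra B" "star_hom A B \<phi>"
    and one: "\<phi> \<one>\<^bsub>A\<^esub> = \<one>\<^bsub>B\<^esub>" and s: "cuntz_family A s"
  shows "cuntz_family B (\<lambda>i. \<phi> (s i))"
  unfolding cuntz_family_def
proof (intro conjI allI impI)
  interpret A: unital_cstar_algebra A by fact
  interpret B: unital_cstar_algebra B by fact
  note cl = star_hom_closed[OF assms(3)]
  have mult: "\<And>u v. u \<in> carrier A \<Longrightarrow> v \<in> carrier A \<Longrightarrow> \<phi> (u \<otimes>\<^bsub>A\<^esub> v) = \<phi> u \<otimes>\<^bsub>B\<^esub> \<phi> v"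
    and adj: "\<And>u. u \<in> carrier A \<Longrightarrow> \<phi> (adj A u) = adj B (\<phi> u)"
    using assms(3) by (simp_all add: star_hom_def)
  have sc: "\<And>i. i \<ge> 1 \<Longrightarrow> s i \<in> carrier A" using s by (simp add: cuntz_family_def)
  have asc: "\<And>i. i \<ge> 1 \<Longrightarrow> adj A (s i) \<in> carrier A" using sc by (rule A.adj_closed)
  show "\<phi> (s i) \<in> carrier B" if "i \<ge> 1" for i using cl[OF sc[OF that]] .
  show "adj B (\<phi> (s i)) \<otimes>\<^bsub>B\<^esub> \<phi> (s j) = (if i = j then \<one>\<^bsub>B\<^esub> else \<zero>\<^bsub>B\<^esub>)"
    if "i \<ge> 1" "j \<ge> 1" for i j
  proof -
    have "adj B (\<phi> (s i)) \<otimes>\<^bsub>B\<^esub> \<phi> (s j) = \<phi> (adj A (s i) \<otimes>\<^bsub>A\<^esub> s j)"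
      using sc asc that by (simp add: mult adj)
    also have "adj A (s i) \<otimes>\<^bsub>A\<^esub> s j = (if i = j then \<one>\<^bsub>A\<^esub> else \<zero>\<^bsub>A\<^esub>)"
      using s that unfolding cuntz_family_def by blast
    finally show ?thesis using one star_hom_zero[OF assms(1-3)] by simp
  qed
  show "cstar_le B (\<Oplus>\<^bsub>B\<^esub>i\<in>{1..k}. \<phi> (s i) \<otimes>\<^bsub>B\<^esub> adj B (\<phi> (s i))) \<one>\<^bsub>B\<^esub>" if "k \<ge> 1" for k
  proof -
    let ?S = "\<Oplus>\<^bsub>A\<^esub>i\<in>{1..k}. s i \<otimes>\<^bsub>A\<^esub> adj A (s i)"
    have terms: "\<And>i. i \<in> {1..k} \<Longrightarrow> s i \<otimes>\<^bsub>A\<^esub> adj A (s i) \<in> carrier A"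
      using sc asc by auto
    have S: "?S \<in> carrier A" using terms by (intro A.finsum_closed) auto
    have "\<phi> ?S = (\<Oplus>\<^bsub>B\<^esub>i\<in>{1..k}. \<phi> (s i \<otimes>\<^bsub>A\<^esub> adj A (s i)))"
      by (rule star_hom_finsum[OF assms(1-3) _ terms]) simp
    also have "\<dots> = (\<Oplus>\<^bsub>B\<^esub>i\<in>{1..k}. \<phi> (s i) \<otimes>\<^bsub>B\<^esub> adj B (\<phi> (s i)))"
      using sc asc cl by (intro B.finsum_cong') (auto simp: mult adj B.adj_closed)
    finally have eq: "\<phi> ?S = (\<Oplus>\<^bsub>B\<^esub>i\<in>{1..k}. \<phi> (s i) \<otimes>\<^bsub>B\<^esub> adj B (\<phi> (s i)))" .
    have "cstar_le A ?S \<one>\<^bsub>A\<^esub>" using s that unfolding cuntz_family_def by blast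
    then obtain z where z: "z \<in> carrier A" "\<one>\<^bsub>A\<^esub> \<ominus>\<^bsub>A\<^esub> ?S = adj A z \<otimes>\<^bsub>A\<^esub> z"
      by (auto simp: cstar_le_def)
    have "\<one>\<^bsub>B\<^esub> \<ominus>\<^bsub>B\<^esub> \<phi> ?S = \<phi> (adj A z \<otimes>\<^bsub>A\<^esub> z)"
      using star_hom_minus[OF assms(1-3) A.one_closed S] z one by simp
    also have "\<dots> = adj B (\<phi> z) \<otimes>\<^bsub>B\<^esub> \<phi> z"
      using z A.adj_closed by (simp add: mult adj)
    finally show ?thesis unfolding eq cstar_le_def using cl[OF z(1)] by blast
  qed
qed

lemma star_hom_restrict:
  assumes "unital_cstar_algebra A" "star_hom A B \<phi>"
  shows "star_hom A B (restrict \<phi> (carrier A))"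
proof -
  interpret A: unital_cstar_algebra A by fact
  show ?thesis
    using assms(2) unfolding star_hom_def
    by (auto simp: A.adj_closed complex_ring_def intro!: A.smult_closed)
qed

text \<open>The images of the generators under \<open>\<psi>\<close> again form a Cuntz family, so the universal property
  applies to them. It speaks about extensional maps, whence the restrictions to \<open>carrier A\<close>.\<close>

lemma cuntz_star_hom_unique:
  fixes B :: "'b star_algebra"
  assumes cuntz: "cuntz_algebra_infinity TYPE('b) A s" and B: "unital_cstar_algebra B"
    and \<phi>: "star_hom A B \<phi>" "\<phi> \<one>\<^bsub>A\<^esub> = \<one>\<^bsub>B\<^esub>" and \<psi>: "star_hom A B \<psi>" "\<psi> \<one>\<^bsub>A\<^esub> = \<one>\<^bsub>B\<^esub>"
    and eq: "\<And>i. i \<ge> 1 \<Longrightarrow> \<phi> (s i) = \<psi> (s i)" and x: "x \<in> carrier A"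
  shows "\<phi> x = \<psi> x"
proof -
  have A: "unital_cstar_algebra A" and s: "cuntz_family A s"
    using cuntz by (simp_all add: cuntz_algebra_infinity_def)
  interpret A: unital_cstar_algebra A by (rule A)
  have sc: "\<And>i. i \<ge> 1 \<Longrightarrow> s i \<in> carrier A" using s by (simp add: cuntz_family_def)
  have t: "cuntz_family B (\<lambda>i. \<psi> (s i))" by (rule star_hom_cuntz_family[OF A B \<psi> s])
  let ?P = "\<lambda>\<phi>. \<phi> \<in> extensional (carrier A) \<and> star_hom A B \<phi> \<and> \<phi> \<one>\<^bsub>A\<^esub> = \<one>\<^bsub>B\<^esub> \<and> (\<forall>i\<ge>1. \<phi> (s i) = \<psi> (s i))"
  have ex: "\<exists>!\<phi>. ?P \<phi>"
    using cuntz B t unfolding cuntz_algebra_infinity_def by blast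
  have P1: "?P (restrict \<phi> (carrier A))"
    using star_hom_restrict[OF A \<phi>(1)] \<phi>(2) eq sc by simp
  have P2: "?P (restrict \<psi> (carrier A))"
    using star_hom_restrict[OF A \<psi>(1)] \<psi>(2) sc by simp
  have "restrict \<phi> (carrier A) = restrict \<psi> (carrier A)"
    by (rule trans[OF the1_equality[where P = ?P, OF ex P1, symmetric] the1_equality[where P = ?P, OF ex P2]])
  then show ?thesis using x by (metis restrict_apply')
qed

text \<open>Write \<open>1 = t\<^sup>* t\<close>. The matrix entries of \<open>\<pi> 1\<close> are then the inner products of the vectors
  \<open>\<pi> t e\<^sub>x = e\<^bsub>f x\<^esub>\<close>, which are orthonormal because \<open>f\<close> is injective.\<close>

lemma l2_representation_unital:
  assumes A: "unital_cstar_algebra A" and \<pi>: "l2_representation A X \<pi>"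
    and t: "t \<in> carrier A" "adj A t \<otimes>\<^bsub>A\<^esub> t = \<one>\<^bsub>A\<^esub>"
    and basis: "\<And>x. x \<in> X \<Longrightarrow> f x \<in> X \<and> \<pi> t (l2_basis x) = l2_basis (f x)"
    and inj: "inj_on f X"
  shows "\<pi> \<one>\<^bsub>A\<^esub> = \<one>\<^bsub>l2_op_algebra X\<^esub>"
proof -
  interpret A: unital_cstar_algebra A by (rule A)
  have hom: "star_hom A (l2_op_algebra X) \<pi>" using \<pi> by (simp add: l2_representation_def)
  have T: "\<pi> t \<in> l2_op X X" and I: "\<pi> \<one>\<^bsub>A\<^esub> \<in> l2_op X X"
    using star_hom_closed[OF hom] t(1) by (auto simp: l2_op_algebra_simps)
  have "\<pi> (adj A t \<otimes>\<^bsub>A\<^esub> t) = compose (l2 X) (l2_adj X X (\<pi> t)) (\<pi> t)"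
    using hom t(1) A.adj_closed[OF t(1)] by (simp add: star_hom_def l2_op_algebra_simps)
  then have one: "\<pi> \<one>\<^bsub>A\<^esub> = compose (l2 X) (l2_adj X X (\<pi> t)) (\<pi> t)"
    using t(2) by simp
  have "\<pi> \<one>\<^bsub>A\<^esub> = (\<lambda>f\<in>l2 X. f)"
  proof (rule l2_op_eqI_basis[OF I l2_op_id])
    fix x assume x: "x \<in> X"
    have b: "l2_basis x \<in> l2 X" "l2_basis (f x) \<in> l2 X" using x basis by (auto intro: l2_basis_in_l2)
    have "\<pi> \<one>\<^bsub>A\<^esub> (l2_basis x) = adj_vector X (\<pi> t) (l2_basis (f x))"
      unfolding one using x b basis by (simp add: compose_def l2_adj_apply[OF T])
    also have "\<dots> = l2_basis x"
    proof
      fix y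
      show "adj_vector X (\<pi> t) (l2_basis (f x)) y = l2_basis x y"
      proof (cases "y \<in> X")
        case True
        then have "adj_vector X (\<pi> t) (l2_basis (f x)) y = l2_basis (f x) (f y)"
          using basis by (simp add: adj_vector_def l2_inner_basis_left)
        then show ?thesis using inj_on_eq_iff[OF inj True x] by (simp add: l2_basis_def)
      qed (use x in \<open>auto simp: adj_vector_def l2_basis_def\<close>)
    qed
    finally show "\<pi> \<one>\<^bsub>A\<^esub> (l2_basis x) = (\<lambda>f\<in>l2 X. f) (l2_basis x)"
      using b by simp
  qed
  then show ?thesis by (simp add: l2_op_algebra_simps)
qed

section \<open>Unitaries, and conjugate branching function systems\<close>

lemma l2_unitary_inverse:
  assumes u: "l2_unitary X Y u"
  shows "f \<in> l2 X \<Longrightarrow> l2_adj X Y u (u f) = f" "g \<in> l2 Y \<Longrightarrow> u (l2_adj X Y u g) = g"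
proof -
  have "compose (l2 X) (l2_adj X Y u) u f = (\<lambda>f\<in>l2 X. f) f" "compose (l2 Y) u (l2_adj X Y u) g = (\<lambda>g\<in>l2 Y. g) g"
    using u by (simp_all add: l2_unitary_def)
  then show "f \<in> l2 X \<Longrightarrow> l2_adj X Y u (u f) = f" "g \<in> l2 Y \<Longrightarrow> u (l2_adj X Y u g) = g"
    by (simp_all add: compose_def)
qed

definition unitary_conj :: "'x set \<Rightarrow> 'y set \<Rightarrow> ('x, 'y) l2_operator \<Rightarrow> ('x, 'x) l2_operator \<Rightarrow> ('y, 'y) l2_operator" where
  "unitary_conj X Y u T = compose (l2 Y) u (compose (l2 Y) T (l2_adj X Y u))"

lemma star_hom_unitary_conj:
  assumes u: "l2_unitary X Y u"
  shows "star_hom (l2_op_algebra X) (l2_op_algebra Y) (unitary_conj X Y u)"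
proof -
  have U: "u \<in> l2_op X Y" using u by (simp add: l2_unitary_def)
  define v where "v = l2_adj X Y u"
  have V: "v \<in> l2_op Y X" unfolding v_def by (rule l2_adj_op[OF U])
  have adjV: "l2_adj Y X v = u" unfolding v_def by (rule l2_adj_adj[OF U])
  have vu: "\<And>f. f \<in> l2 X \<Longrightarrow> v (u f) = f" unfolding v_def by (rule l2_unitary_inverse(1)[OF u])
  have TV: "compose (l2 Y) T v \<in> l2_op Y X" if "T \<in> l2_op X X" for T
    by (rule l2_op_compose[OF V that])
  show ?thesis
    unfolding star_hom_def l2_op_algebra_simps unitary_conj_def v_def[symmetric]
  proof (intro conjI ballI allI funcsetI)
    fix S assume S: "S \<in> l2_op X X"
    show "compose (l2 Y) u (compose (l2 Y) S v) \<in> l2_op Y Y"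
      by (rule l2_op_compose[OF TV[OF S] U])
    have "l2_adj Y Y (compose (l2 Y) u (compose (l2 Y) S v))
        = compose (l2 Y) (compose (l2 X) u (l2_adj X X S)) v"
      unfolding l2_adj_compose[OF TV[OF S] U] l2_adj_compose[OF V S] adjV v_def[symmetric] ..
    also have "\<dots> = compose (l2 Y) u (compose (l2 Y) (l2_adj X X S) v)"
      unfolding compose_def by (rule restrict_ext) (simp add: l2_op_closed[OF V])
    finally show "compose (l2 Y) u (compose (l2 Y) (l2_adj X X S) v)
        = l2_adj Y Y (compose (l2 Y) u (compose (l2 Y) S v))" ..
    show "compose (l2 Y) u (compose (l2 Y) (\<lambda>f\<in>l2 X. \<lambda>x. c * S f x) v)
        = (\<lambda>f\<in>l2 Y. \<lambda>x. c * compose (l2 Y) u (compose (l2 Y) S v) f x)" for c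
      unfolding compose_def
      by (rule restrict_ext) (simp add: l2_op_closed[OF V] l2_op_scale[OF U] l2_op_closed[OF S])
    fix T assume T: "T \<in> l2_op X X"
    show "compose (l2 Y) u (compose (l2 Y) (\<lambda>f\<in>l2 X. \<lambda>x. S f x + T f x) v)
        = (\<lambda>f\<in>l2 Y. \<lambda>x. compose (l2 Y) u (compose (l2 Y) S v) f x + compose (l2 Y) u (compose (l2 Y) T v) f x)"
      unfolding compose_def
      by (rule restrict_ext)
        (simp add: l2_op_closed[OF V] l2_op_add[OF U] l2_op_closed[OF S] l2_op_closed[OF T])
    show "compose (l2 Y) u (compose (l2 Y) (compose (l2 X) S T) v)
        = compose (l2 Y) (compose (l2 Y) u (compose (l2 Y) S v)) (compose (l2 Y) u (compose (l2 Y) T v))"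
      unfolding compose_def
      by (rule restrict_ext)
        (simp add: l2_op_closed[OF V] l2_op_closed[OF U] vu l2_op_closed[OF T])
  qed
qed

lemma star_hom_compose:
  assumes "star_hom A B \<phi>" "star_hom B C \<psi>"
  shows "star_hom A C (\<lambda>x. \<psi> (\<phi> x))"
  using assms unfolding star_hom_def by (auto simp: Pi_iff)

text \<open>Composition with \<open>c\<close>, a map from the new index set \<open>Y\<close> to the old one \<open>X\<close>.\<close>

definition reindex :: "'x set \<Rightarrow> 'y set \<Rightarrow> ('y \<Rightarrow> 'x) \<Rightarrow> ('x, 'y) l2_operator" where
  "reindex X Y c = (\<lambda>f\<in>l2 X. \<lambda>y. if y \<in> Y then f (c y) else 0)"

lemma reindex_in_l2_op:
  assumes c: "inj_on c Y" "c ` Y \<subseteq> X"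
  shows "reindex X Y c \<in> l2_op X Y"
proof -
  have bound: "L2_set (\<lambda>y. cmod (if y \<in> Y then f (c y) else 0)) F \<le> l2_norm f"
    if f: "f \<in> l2 X" and F: "finite F" for f F
  proof -
    have "(\<Sum>y\<in>F. (cmod (if y \<in> Y then f (c y) else 0))\<^sup>2) = (\<Sum>y\<in>F \<inter> Y. (cmod (f (c y)))\<^sup>2)"
      unfolding sum.inter_restrict[OF F] by (rule sum.cong) auto
    also have "\<dots> = (\<Sum>x\<in>c ` (F \<inter> Y). (cmod (f x))\<^sup>2)"
      by (subst sum.reindex) (use c in \<open>auto intro: inj_on_subset\<close>)
    finally show ?thesis
      using L2_set_le_l2_norm[OF f, of "c ` (F \<inter> Y)"] by (simp add: L2_set_def)
  qed
  show ?thesis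
  proof (rule l2_opI[where K = 1])
    fix f assume f: "f \<in> l2 X"
    show "reindex X Y c f \<in> l2 Y"
      using l2I[OF _ bound[OF f], of Y] f by (simp add: reindex_def)
    show "l2_norm (reindex X Y c f) \<le> 1 * l2_norm f"
      using l2_norm_leI[OF bound[OF f]] f by (simp add: reindex_def)
  qed (auto simp: reindex_def l2_add l2_scale)
qed

text \<open>Substituting along \<open>c\<close> in the inner product shows that the adjoint is the reindexing along the
  inverse bijection.\<close>

lemma l2_unitary_reindex:
  assumes c: "bij_betw c Y X"
  shows "l2_unitary X Y (reindex X Y c)"
proof -
  let ?d = "inv_into Y c"
  have d: "bij_betw ?d X Y" by (rule bij_betw_inv_into[OF c])
  have U: "reindex X Y c \<in> l2_op X Y" and V: "reindex Y X ?d \<in> l2_op Y X"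
    using c d by (auto intro!: reindex_in_l2_op simp: bij_betw_def)
  have adj: "l2_adj X Y (reindex X Y c) = reindex Y X ?d"
  proof (rule l2_adj_eqI[OF U V])
    fix f g assume f: "f \<in> l2 X" and g: "g \<in> l2 Y"
    have "l2_inner (reindex X Y c f) g = infsum (\<lambda>y. cnj (f (c y)) * g y) Y"
      unfolding l2_inner_def using f by (intro infsum_cong_neutral) (auto simp: reindex_def)
    also have "\<dots> = infsum (\<lambda>y. cnj (f (c y)) * g (?d (c y))) Y"
      using c by (intro infsum_cong) (simp add: bij_betw_inv_into_left)
    also have "\<dots> = infsum (\<lambda>x. cnj (f x) * g (?d x)) X"
      by (rule infsum_reindex_bij_betw[OF c])
    also have "\<dots> = l2_inner f (reindex Y X ?d g)"
      unfolding l2_inner_def using g by (intro infsum_cong_neutral) (auto simp: reindex_def)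
    finally show "l2_inner (reindex X Y c f) g = l2_inner f (reindex Y X ?d g)" .
  qed
  have cancel: "reindex Y X ?d (reindex X Y c f) = f" if f: "f \<in> l2 X" for f
    using f l2_op_closed[OF U f] bij_betw_inv_into_right[OF c] bij_betwE[OF d] l2_outside[OF f]
    by (auto simp: reindex_def fun_eq_iff)
  have cancel': "reindex X Y c (reindex Y X ?d g) = g" if g: "g \<in> l2 Y" for g
    using g l2_op_closed[OF V g] bij_betw_inv_into_left[OF c] bij_betwE[OF c] l2_outside[OF g]
    by (auto simp: reindex_def fun_eq_iff)
  show "l2_unitary X Y (reindex X Y c)"
    unfolding l2_unitary_def adj compose_def
    by (intro conjI U restrict_ext cancel cancel')
qed

lemma reindex_basis:
  assumes c: "bij_betw c Y X" and y: "y \<in> Y"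
  shows "reindex X Y c (l2_basis (c y)) = l2_basis y"
proof -
  have "l2_basis (c y) \<in> l2 X" using bij_betwE[OF c] y by (intro l2_basis_in_l2) auto
  moreover have "c z = c y \<longleftrightarrow> z = y" if "z \<in> Y" for z
    using inj_on_eq_iff[OF bij_betw_imp_inj_on[OF c] that y] .
  ultimately show ?thesis using y by (auto simp: reindex_def l2_basis_def fun_eq_iff)
qed

text \<open>Let \<open>u\<close> be the reindexing along the conjugacy \<open>c\<close>. For each generator, conjugating \<open>\<pi>\<close> by \<open>u\<close> gives
  an operator that agrees with that of \<open>\<rho>\<close> on the basis, hence everywhere; then uniqueness of
  unital *-homomorphisms on the Cuntz algebra takes over.\<close>

theorem conjugate_branching_systems_unitarily_equivalent:
  fixes A :: "'a star_algebra" and X :: "'x set" and Y :: "'y set"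
  assumes cuntz: "cuntz_algebra_infinity TYPE(('y, 'y) l2_operator) A s"
    and \<pi>: "l2_representation A X \<pi>"
    and \<pi>_basis: "\<And>i x. i \<ge> 1 \<Longrightarrow> x \<in> X \<Longrightarrow> \<pi> (s i) (l2_basis x) = l2_basis (a i x)"
    and \<rho>: "l2_representation A Y \<rho>"
    and \<rho>_basis: "\<And>i y. i \<ge> 1 \<Longrightarrow> y \<in> Y \<Longrightarrow> \<rho> (s i) (l2_basis y) = l2_basis (b i y)"
    and c: "bij_betw c Y X"
    and b: "\<And>i y. i \<ge> 1 \<Longrightarrow> y \<in> Y \<Longrightarrow> b i y \<in> Y" "\<And>i. i \<ge> 1 \<Longrightarrow> inj_on (b i) Y"
    and conj: "\<And>i y. i \<ge> 1 \<Longrightarrow> y \<in> Y \<Longrightarrow> c (b i y) = a i (c y)"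
  shows "unitarily_equivalent A X \<pi> Y \<rho>"
proof -
  define u where "u = reindex X Y c"
  define \<pi>' where "\<pi>' = (\<lambda>x. unitary_conj X Y u (\<pi> x))"
  have A: "unital_cstar_algebra A" and s: "cuntz_family A s"
    using cuntz by (simp_all add: cuntz_algebra_infinity_def)
  have sc: "\<And>i. i \<ge> 1 \<Longrightarrow> s i \<in> carrier A" and iso: "\<And>i. i \<ge> 1 \<Longrightarrow> adj A (s i) \<otimes>\<^bsub>A\<^esub> s i = \<one>\<^bsub>A\<^esub>"
    using s by (simp_all add: cuntz_family_def)
  have u: "l2_unitary X Y u" unfolding u_def by (rule l2_unitary_reindex[OF c])
  have U: "u \<in> l2_op X Y" using u by (simp add: l2_unitary_def)
  have hom: "star_hom A (l2_op_algebra X) \<pi>" "star_hom A (l2_op_algebra Y) \<rho>"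
    using \<pi> \<rho> by (simp_all add: l2_representation_def)
  have hom': "star_hom A (l2_op_algebra Y) \<pi>'"
    unfolding \<pi>'_def by (rule star_hom_compose[OF hom(1) star_hom_unitary_conj[OF u]])
  have \<pi>'_basis: "\<pi>' (s i) (l2_basis y) = l2_basis (b i y)" if i: "i \<ge> 1" and y: "y \<in> Y" for i y
  proof -
    have cX: "c y \<in> X" using bij_betwE[OF c] y by blast
    have e: "l2_basis y \<in> l2 Y" "l2_basis (c y) \<in> l2 X"
      using y cX by (auto intro: l2_basis_in_l2)
    have "u (l2_basis (c y)) = l2_basis y" unfolding u_def by (rule reindex_basis[OF c y])
    then have "l2_adj X Y u (l2_basis y) = l2_basis (c y)"
      using l2_unitary_inverse(1)[OF u e(2)] by simp
    then have "\<pi>' (s i) (l2_basis y) = u (\<pi> (s i) (l2_basis (c y)))"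
      using e by (simp add: \<pi>'_def unitary_conj_def compose_def)
    also have "\<dots> = u (l2_basis (c (b i y)))"
      by (simp add: \<pi>_basis[OF i cX] conj[OF i y])
    also have "\<dots> = l2_basis (b i y)"
      unfolding u_def by (rule reindex_basis[OF c b(1)[OF i y]])
    finally show ?thesis .
  qed
  have unital: "\<tau> \<one>\<^bsub>A\<^esub> = \<one>\<^bsub>l2_op_algebra Y\<^esub>"
    if "star_hom A (l2_op_algebra Y) \<tau>" "\<And>y. y \<in> Y \<Longrightarrow> \<tau> (s 1) (l2_basis y) = l2_basis (b 1 y)" for \<tau>
    by (rule l2_representation_unital[OF A _ sc[of 1] iso[of 1], where f = "b 1"])
      (use that b[of 1] in \<open>auto simp: l2_representation_def\<close>)
  have gen: "\<pi>' (s i) = \<rho> (s i)" if i: "i \<ge> 1" for i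
    using star_hom_closed[OF hom' sc[OF i]] star_hom_closed[OF hom(2) sc[OF i]]
    by (intro l2_op_eqI_basis[of _ Y Y]) (simp_all add: l2_op_algebra_simps \<pi>'_basis[OF i] \<rho>_basis[OF i])
  have "\<pi>' x = \<rho> x" if "x \<in> carrier A" for x
    by (rule cuntz_star_hom_unique[OF cuntz l2_op_unital_cstar_algebra hom' _ hom(2) _ gen that])
      (auto intro!: unital hom' hom(2) \<pi>'_basis \<rho>_basis)
  then show ?thesis
    unfolding unitarily_equivalent_def using u by (auto simp: \<pi>'_def unitary_conj_def)
qed

text \<open>The continued fraction map is the conjugacy; it points from \<open>Ninf\<close> to \<open>Omega\<close>, so that the
  unitary it induces by composition maps \<open>l2 Omega\<close> to \<open>l2 Ninf\<close>.\<close>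

theorem theorem1p4:
  fixes A :: "'a star_algebra" and s :: "nat \<Rightarrow> 'a"
    and \<pi>\<alpha> :: "'a \<Rightarrow> (real, real) l2_operator"
    and \<pi>\<beta> :: "'a \<Rightarrow> (nat \<Rightarrow> nat, nat \<Rightarrow> nat) l2_operator"
  assumes "cuntz_algebra_infinity TYPE((real, real) l2_operator) A s"
    and "cuntz_algebra_infinity TYPE((nat \<Rightarrow> nat, nat \<Rightarrow> nat) l2_operator) A s"
    and "l2_representation A Omega \<pi>\<alpha>"
    and "\<And>i x. i \<ge> 1 \<Longrightarrow> x \<in> Omega \<Longrightarrow> \<pi>\<alpha> (s i) (l2_basis x) = l2_basis (alpha i x)"
    and "l2_representation A Ninf \<pi>\<beta>"
    and "\<And>i a. i \<ge> 1 \<Longrightarrow> a \<in> Ninf \<Longrightarrow> \<pi>\<beta> (s i) (l2_basis a) = l2_basis (beta i a)"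
  shows "unitarily_equivalent A Omega \<pi>\<alpha> Ninf \<pi>\<beta>"
proof (rule conjugate_branching_systems_unitarily_equivalent[OF assms(2-6) bij_betw_cf_value])
  fix i :: nat and y assume "i \<ge> 1" "y \<in> Ninf"
  then show "cf_value (beta i y) = alpha i (cf_value y)" by (rule cf_value_beta)
qed (simp_all add: beta_in_Ninf inj_on_beta)

end
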